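(* Let $n\ge 3$ and let $P$ be a tangential hyperbolic $n$-gon with inradius $r(P)$. Then $$\mathrm{Area}(P)\;\geq\; (n-2)\pi - 2n\,\cos^{-1}\!\left(\sin(\pi/n)\,\cosh r(P)\right),$$ with equality if and only if $P$ is regular.
   Context: A hyperbolic $n$-gon is a polygon with $n$ geodesic sides in the hyperbolic plane of constant curvature $-1$; all of its vertices are assumed to lie in the hyperbolic plane (no ideal vertices). A polygon is tangential if all its sides are tangent to the same circle (its incircle); $r(P)$ denotes the (hyperbolic) radius of the incircle. $\mathrm{Area}(P)$ is the hyperbolic area of $P$. A polygon is regular if all its sides are equal and all its interior angles are equal. *)

theory Defs
  imports "HOL-Analysis.Analysis"
begin

text \<open>
  The hyperbolic plane of curvature \<open>-1\<close> in the Beltrami--Klein model: the points are those of the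
  open unit disc of \<open>real^2\<close>, and the geodesics are the Euclidean chords, so that the geodesic
  segment joining two points is their \<open>closed_segment\<close>.
\<close>

definition hplane :: "(real^2) set" where
  "hplane = ball 0 1"

definition hdist :: "real^2 \<Rightarrow> real^2 \<Rightarrow> real" where
  "hdist x y = arcosh ((1 - x \<bullet> y) / (sqrt (1 - (norm x)\<^sup>2) * sqrt (1 - (norm y)\<^sup>2)))"

text \<open>The Riemannian metric at \<open>x\<close>; the Klein model is not conformal, so angles have to be measured
  with it and not with the Euclidean inner product.\<close>

definition hinner :: "real^2 \<Rightarrow> real^2 \<Rightarrow> real^2 \<Rightarrow> real" where
  "hinner x u w = (u \<bullet> w) / (1 - (norm x)\<^sup>2) + (x \<bullet> u) * (x \<bullet> w) / (1 - (norm x)\<^sup>2)\<^sup>2"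

definition hangle :: "real^2 \<Rightarrow> real^2 \<Rightarrow> real^2 \<Rightarrow> real" where
  "hangle x u w = arccos (hinner x u w / (sqrt (hinner x u u) * sqrt (hinner x w w)))"

text \<open>The density is the square root of the determinant of the metric \<open>hinner x\<close>, whose eigenvalues
  are \<open>1 / (1 - (norm x)\<^sup>2)\<^sup>2\<close> (radially) and \<open>1 / (1 - (norm x)\<^sup>2)\<close>.\<close>

definition harea :: "(real^2) set \<Rightarrow> real" where
  "harea S = (LINT x:S|lborel. 1 / (1 - (norm x)\<^sup>2) powr (3/2))"

definition hline :: "real^2 \<Rightarrow> real^2 \<Rightarrow> (real^2) set" where
  "hline a b = affine hull {a, b} \<inter> hplane"

definition hcircle :: "real^2 \<Rightarrow> real \<Rightarrow> (real^2) set" where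
  "hcircle c r = {x \<in> hplane. hdist c x = r}"

text \<open>A polygon is given by the cyclic list of its vertices.\<close>

definition vertex :: "(real^2) list \<Rightarrow> nat \<Rightarrow> real^2" where
  "vertex P i = P ! (i mod length P)"

definition side :: "(real^2) list \<Rightarrow> nat \<Rightarrow> (real^2) set" where
  "side P i = closed_segment (vertex P i) (vertex P (Suc i))"

definition boundary :: "(real^2) list \<Rightarrow> (real^2) set" where
  "boundary P = (\<Union>i<length P. side P i)"

text \<open>Polygons are simple. By the collinearity condition the sides are nondegenerate, adjacent sides
  meet only in their common vertex, and no interior angle equals \<open>pi\<close>.\<close>

definition hpolygon :: "nat \<Rightarrow> (real^2) list \<Rightarrow> bool" where
  "hpolygon n P \<longleftrightarrow>
     length P = n \<and> set P \<subseteq> hplane \<and>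
     (\<forall>i<n. \<not> collinear {vertex P i, vertex P (i + 1), vertex P (i + 2)}) \<and>
     (\<forall>i<n. \<forall>j<n. i \<noteq> j \<and> j \<noteq> (i + 1) mod n \<and> i \<noteq> (j + 1) mod n \<longrightarrow>
        side P i \<inter> side P j = {})"

text \<open>The boundary is a compact subset of the open disc, so its Euclidean inside is also the
  component of its complement in the hyperbolic plane that is bounded for the hyperbolic metric.\<close>

definition region :: "(real^2) list \<Rightarrow> (real^2) set" where
  "region P = boundary P \<union> inside (boundary P)"

text \<open>The function \<open>hangle\<close> takes values in \<open>[0, pi]\<close>. The interior angle is this value if the sector
  between the two sides (which contains the direction \<open>u + w\<close>) lies locally in the polygon; otherwise
  the vertex is reflex.\<close>

definition interior_angle :: "(real^2) list \<Rightarrow> nat \<Rightarrow> real" where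
  "interior_angle P i =
     (let x = vertex P i;
          u = vertex P (i + length P - 1) - x;
          w = vertex P (i + 1) - x
      in if \<exists>e>0. \<forall>t. 0 < t \<and> t < e \<longrightarrow> x + t *\<^sub>R (u + w) \<in> inside (boundary P)
         then hangle x u w else 2 * pi - hangle x u w)"

definition regular :: "(real^2) list \<Rightarrow> bool" where
  "regular P \<longleftrightarrow>
     (\<forall>i<length P. \<forall>j<length P.
        hdist (vertex P i) (vertex P (i + 1)) = hdist (vertex P j) (vertex P (j + 1)) \<and>
        interior_angle P i = interior_angle P j)"

text \<open>A side is tangent to a circle if the geodesic line containing it meets the circle in exactly
  one point and that point lies on the side itself. The inradius \<open>r(P)\<close> of a tangential polygon is the
  \<open>r\<close> for which \<open>is_incircle P c r\<close> holds for some \<open>c\<close>.\<close>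

definition side_tangent :: "(real^2) list \<Rightarrow> nat \<Rightarrow> (real^2) set \<Rightarrow> bool" where
  "side_tangent P i C \<longleftrightarrow>
     (\<exists>t \<in> side P i. hline (vertex P i) (vertex P (i + 1)) \<inter> C = {t})"

definition is_incircle :: "(real^2) list \<Rightarrow> real^2 \<Rightarrow> real \<Rightarrow> bool" where
  "is_incircle P c r \<longleftrightarrow>
     c \<in> hplane \<and> r > 0 \<and> (\<forall>i<length P. side_tangent P i (hcircle c r))"

end

theory Submission
  imports Defs
begin

text \<open>
  A half-turn of the hyperbolic plane moves the incentre to \<open>0\<close>, where the incircle becomes a Euclidean
  circle of radius \<open>q = tanh r\<close>. Let \<open>\<alpha> k\<close> be the angle at the incentre between the direction of the
  \<open>k\<close>-th vertex and that of either adjacent point of tangency. The sides wind monotonically around the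
  incentre, and by simplicity they do so exactly once, hence the \<open>\<alpha> k\<close> sum to \<open>pi\<close>. A right triangle with angle
  \<open>a\<close> at the incentre and adjacent leg \<open>r\<close> has area \<open>pi / 2 - a - arccos (cosh r * sin a)\<close>, so that the area of the
  polygon is \<open>(n - 2) * pi\<close> minus twice the sum of the \<open>arccos (cosh r * sin (\<alpha> k))\<close>. As
  \<open>arccos (cosh r * sin a)\<close> is strictly concave in \<open>a\<close>, Jensen's inequality gives the bound, with equality
  only if all \<open>\<alpha> k\<close> agree; and the interior angle at a vertex determines its \<open>\<alpha> k\<close>.
\<close>

section \<open>Half-turns of the Klein disc\<close>

text \<open>The metric notions of the Klein model are written through
  \<open>1 - x \<bullet> y\<close>, up to sign the Lorentz product of the lifts
  \<open>(1, x)\<close> and \<open>(1, y)\<close>. A half-turn multiplies it by one factor per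
  point, so invariance of distance and angle becomes cancellation. It is also its own inverse, so an
  inclusion between images yields its converse.

  Monotone winding has three sources. Uniqueness of the common point makes a tangency point the foot
  of the perpendicular from the incentre; its position on the side itself separates the two end
  vertices; noncollinearity of consecutive vertices keeps the same tangent line from occurring twice
  in a row. What these local conditions cannot exclude is a star polygon going round several times.
  Hence directions are kept as real numbers, not modulo \<open>2 * pi\<close>, and a crossing is
  found by comparing the curve at \<theta> and at \<open>\<theta> + 2 * pi\<close>. With winding
  number one the polygon bounds an intersection of half-planes, whose convexity settles its inside
  without a Jordan curve argument.\<close>

lemma hplane_iff_inner: "x \<in> hplane \<longleftrightarrow> x \<bullet> x < 1"
  by (simp add: hplane_def norm_lt_square)

lemma inner_less_one:
  assumes "x \<in> hplane" "y \<in> hplane" shows "x \<bullet> y < 1"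
proof -
  have "x \<bullet> y \<le> norm x * norm y" by (rule norm_cauchy_schwarz)
  also have "norm x * norm y < 1 * 1"
    using assms by (intro mult_strict_mono) (auto simp: hplane_def)
  finally show ?thesis by simp
qed

text \<open>Up to the denominator this is a minor of the Gram matrix of the lifts
  \<open>(1, x)\<close>, \<open>(1, y)\<close>, \<open>(1, z)\<close> for the Lorentz product; in
  this form the metric can be transported by a half-turn without differentiating it.\<close>

lemma hinner_chords:
  "hinner x (y - x) (z - x)
     = ((1 - x \<bullet> y) * (1 - x \<bullet> z) - (1 - x \<bullet> x) * (1 - y \<bullet> z)) / (1 - x \<bullet> x)\<^sup>2"
proof (cases "1 - x \<bullet> x = 0")
  case False
  have "hinner x (y - x) (z - x)
     = ((1 - x \<bullet> x) * ((y - x) \<bullet> (z - x)) + (x \<bullet> (y - x)) * (x \<bullet> (z - x))) / (1 - x \<bullet> x)\<^sup>2"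
    unfolding hinner_def power2_norm_eq_inner add_divide_distrib
    using False by (simp add: power2_eq_square)
  also have "(1 - x \<bullet> x) * ((y - x) \<bullet> (z - x)) + (x \<bullet> (y - x)) * (x \<bullet> (z - x))
     = (1 - x \<bullet> y) * (1 - x \<bullet> z) - (1 - x \<bullet> x) * (1 - y \<bullet> z)"
    by (simp add: inner_diff_left inner_diff_right algebra_simps inner_commute)
  finally show ?thesis .
\<comment> \<open>If \<open>x \<bullet> x = 1\<close>, both sides are divisions by 0 and hence
  0.\<close>
qed (simp add: hinner_def power2_norm_eq_inner)

lemma hinner_scaleR: "hinner x (a *\<^sub>R u) (b *\<^sub>R w) = a * b * hinner x u w"
  by (simp add: hinner_def algebra_simps add_divide_distrib)

lemma hangle_scaleR:
  assumes "a > 0" "b > 0"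
  shows "hangle x (a *\<^sub>R u) (b *\<^sub>R w) = hangle x u w"
  using assms by (simp add: hangle_def hinner_scaleR real_sqrt_mult)

text \<open>The half-turn about the midpoint of \<open>0\<close> and \<open>c\<close>: on the hyperboloid it is minus the Lorentz
  reflection in the vector \<open>(1,0) + (1,c) / sqrt (1 - c \<bullet> c)\<close>.\<close>

definition half_turn :: "real^2 \<Rightarrow> real^2 \<Rightarrow> real^2" where
  "half_turn c x = (1 / (1 - c \<bullet> x)) *\<^sub>R
     (c - sqrt (1 - c \<bullet> c) *\<^sub>R x - (c \<bullet> x / (1 + sqrt (1 - c \<bullet> c))) *\<^sub>R c)"

text \<open>The half-turn is a linear Lorentz isometry of the lifts followed by rescaling the time
  coordinate back to 1; the denominators record the rescaling of each point. Invariance of the disc,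
  of \<open>hdist\<close>, of \<open>hangle\<close> and of the area all rest on this
  identity.\<close>

lemma one_minus_inner_half_turn:
  assumes c: "c \<in> hplane" and x: "x \<in> hplane" and y: "y \<in> hplane"
  shows "1 - half_turn c x \<bullet> half_turn c y
    = (1 - c \<bullet> c) * (1 - x \<bullet> y) / ((1 - c \<bullet> x) * (1 - c \<bullet> y))"
proof -
  define s where "s = sqrt (1 - c \<bullet> c)"
  have s: "s > 0" and cc: "c \<bullet> c = 1 - s\<^sup>2"
    using c by (auto simp: s_def hplane_iff_inner)
  \<comment> \<open>Writing \<open>c \<bullet> x\<close> and \<open>c \<bullet> y\<close> as
    multiples of \<open>1 + s\<close> clears that denominator, so that a polynomial identity
    remains.\<close>
  define m k where "m = c \<bullet> x / (1 + s)" and "k = c \<bullet> y / (1 + s)"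
  have m: "c \<bullet> x = m * (1 + s)" and k: "c \<bullet> y = k * (1 + s)"
    using s by (auto simp: m_def k_def)
  have l: "1 - c \<bullet> x > 0" "1 - c \<bullet> y > 0" using assms inner_less_one by auto
  have "(c - s *\<^sub>R x - m *\<^sub>R c) \<bullet> (c - s *\<^sub>R y - k *\<^sub>R c)
    = (1 - c \<bullet> x) * (1 - c \<bullet> y) - s\<^sup>2 * (1 - x \<bullet> y)"
    by (simp add: inner_diff_left inner_diff_right inner_commute[of x c] inner_commute[of y c] cc m k)
       (simp add: algebra_simps power2_eq_square power3_eq_cube)
  then have "half_turn c x \<bullet> half_turn c y
    = ((1 - c \<bullet> x) * (1 - c \<bullet> y) - s\<^sup>2 * (1 - x \<bullet> y)) / ((1 - c \<bullet> x) * (1 - c \<bullet> y))"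
    by (simp add: half_turn_def s_def[symmetric] m_def k_def)
  then show ?thesis using l by (simp add: cc diff_divide_distrib)
qed

lemma half_turn_in_hplane:
  assumes "c \<in> hplane" "x \<in> hplane" shows "half_turn c x \<in> hplane"
proof -
  have "0 < 1 - half_turn c x \<bullet> half_turn c x"
    unfolding one_minus_inner_half_turn[OF assms assms(2)]
    using assms by (intro divide_pos_pos mult_pos_pos) (auto simp: inner_less_one)
  then show ?thesis by (simp add: hplane_iff_inner)
qed

lemma half_turn_center:
  assumes "c \<in> hplane" shows "half_turn c c = 0"
proof -
  define s where "s = sqrt (1 - c \<bullet> c)"
  have s: "s > 0" and cc: "c \<bullet> c = 1 - s\<^sup>2"
    using assms by (auto simp: s_def hplane_iff_inner)
  have "(1 - s\<^sup>2) / (1 + s) = 1 - s"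
    using s by (simp add: field_simps power2_eq_square)
  then have "c - s *\<^sub>R c - (c \<bullet> c / (1 + s)) *\<^sub>R c = (1 - s - (1 - s)) *\<^sub>R c"
    by (simp add: cc scaleR_left_diff_distrib)
  then show ?thesis
    by (simp add: half_turn_def s_def[symmetric])
qed

lemma half_turn_zero [simp]: "half_turn c 0 = c"
  by (simp add: half_turn_def)

lemma half_turn_half_turn:
  assumes "c \<in> hplane" "x \<in> hplane" shows "half_turn c (half_turn c x) = x"
proof -
  define s where "s = sqrt (1 - c \<bullet> c)"
  have s: "s > 0" and cc: "c \<bullet> c = 1 - s\<^sup>2"
    using assms by (auto simp: s_def hplane_iff_inner)
  define l where "l = 1 - c \<bullet> x"
  have l: "l > 0" using assms by (simp add: l_def inner_less_one)
  have "1 - c \<bullet> half_turn c x = s\<^sup>2 / l"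
    using one_minus_inner_half_turn[OF assms(1) _ assms(2), of 0] by (simp add: hplane_def cc l_def)
  then have e: "c \<bullet> half_turn c x = 1 - s\<^sup>2 / l" by simp
  define m where "m = (1 - l) / (1 + s)"
  have lm: "l = 1 - (1 + s) * m" using s by (simp add: m_def)
  define u where "u = half_turn c x"
  have u: "u = (1/l) *\<^sub>R (c - s *\<^sub>R x - m *\<^sub>R c)"
    by (simp add: u_def half_turn_def s_def[symmetric] l_def m_def)
  have "half_turn c u = (l / s\<^sup>2) *\<^sub>R (c - s *\<^sub>R u - ((1 - s\<^sup>2 / l) / (1 + s)) *\<^sub>R c)"
    unfolding half_turn_def s_def[symmetric] using e by (simp add: u_def)
  also have "\<dots> = (l / s\<^sup>2 - (1 - m) / s - (l / s\<^sup>2) * ((1 - s\<^sup>2 / l) / (1 + s))) *\<^sub>R c + x"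
    unfolding u using s l by (simp add: algebra_simps) (simp add: field_simps power2_eq_square flip: scaleR_left.add scaleR_left.diff)
  also have "l / s\<^sup>2 - (1 - m) / s - (l / s\<^sup>2) * ((1 - s\<^sup>2 / l) / (1 + s)) = 0"
  proof -
    have "(l / s\<^sup>2) * ((1 - s\<^sup>2 / l) / (1 + s)) = (l - s\<^sup>2) / (s\<^sup>2 * (1 + s))"
    proof -
      have "1 - s\<^sup>2 / l = (l - s\<^sup>2) / l" using l by (simp add: diff_divide_distrib)
      then show ?thesis using l by simp
    qed
    moreover have "l / s\<^sup>2 - (1 - m) / s - (l - s\<^sup>2) / (s\<^sup>2 * (1 + s))
      = (l * (1 + s) - (1 - m) * s * (1 + s) - (l - s\<^sup>2)) / (s\<^sup>2 * (1 + s))"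
    proof -
      have "l / s\<^sup>2 = l * (1 + s) / (s\<^sup>2 * (1 + s))" using s by simp
      moreover have "(1 - m) / s = (1 - m) * s * (1 + s) / (s\<^sup>2 * (1 + s))"
        using s by (simp add: power2_eq_square)
      ultimately show ?thesis by (simp add: diff_divide_distrib)
    qed
    moreover have "l * (1 + s) - (1 - m) * s * (1 + s) - (l - s\<^sup>2) = 0"
      by (simp add: lm algebra_simps power2_eq_square)
    ultimately show ?thesis by (simp del: times_divide_eq_left times_divide_eq_right)
  qed
  finally show ?thesis by (simp add: u_def)
qed

lemma half_turn_image_hplane_subset:
  assumes "c \<in> hplane" "S \<subseteq> hplane" shows "half_turn c ` S \<subseteq> hplane"
  using assms half_turn_in_hplane by auto

lemma half_turn_image_involution:
  assumes "c \<in> hplane" "S \<subseteq> hplane" shows "half_turn c ` half_turn c ` S = S"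
  using assms half_turn_half_turn by (auto simp: image_iff subset_iff)

lemma inj_on_half_turn:
  assumes "c \<in> hplane" "S \<subseteq> hplane" shows "inj_on (half_turn c) S"
  by (metis assms half_turn_half_turn inj_onI subsetD)

lemma hplane_convex: "convex hplane" by (simp add: hplane_def)

text \<open>Numerator and denominator of the half-turn are affine in the point, so it is a
  projective map: the weights of the two ends are multiplied by the denominators there and
  renormalised.\<close>

lemma half_turn_affine:
  assumes c: "c \<in> hplane" and "a \<in> hplane" "b \<in> hplane"
    and "(1 - t) *\<^sub>R a + t *\<^sub>R b \<in> hplane"
  defines "u \<equiv> t * (1 - c \<bullet> b) / ((1 - t) * (1 - c \<bullet> a) + t * (1 - c \<bullet> b))"
  shows "half_turn c ((1 - t) *\<^sub>R a + t *\<^sub>R b)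
    = (1 - u) *\<^sub>R half_turn c a + u *\<^sub>R half_turn c b"
proof -
  define N where "N x = c - sqrt (1 - c \<bullet> c) *\<^sub>R x - (c \<bullet> x / (1 + sqrt (1 - c \<bullet> c))) *\<^sub>R c" for x
  have h: "half_turn c x = (1 / (1 - c \<bullet> x)) *\<^sub>R N x" for x
    by (simp add: half_turn_def N_def)
  define p q where "p = 1 - c \<bullet> a" and "q = 1 - c \<bullet> b"
  have p: "p > 0" and q: "q > 0" using assms inner_less_one by (auto simp: p_def q_def)
  define l where "l = (1 - t) * p + t * q"
  have l: "1 - c \<bullet> ((1 - t) *\<^sub>R a + t *\<^sub>R b) = l"
    by (simp add: l_def p_def q_def inner_add_right algebra_simps)
  have l0: "l > 0" using inner_less_one[OF c assms(4)] l by simp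
  have u: "u = t * q / l" "1 - u = (1 - t) * p / l"
    using l0 by (simp_all add: u_def p_def[symmetric] q_def[symmetric] l_def[symmetric])
       (simp add: field_simps l_def)
  have N: "N ((1 - t) *\<^sub>R a + t *\<^sub>R b) = (1 - t) *\<^sub>R N a + t *\<^sub>R N b"
    by (simp add: N_def inner_add_right algebra_simps add_divide_distrib diff_divide_distrib)
  show ?thesis
    unfolding h l N p_def[symmetric] q_def[symmetric] u(2) unfolding u(1)
    using p q l0 by (simp add: scaleR_add_right)
qed

lemma half_turn_closed_segment_subset:
  assumes "c \<in> hplane" "a \<in> hplane" "b \<in> hplane"
  shows "half_turn c ` closed_segment a b \<subseteq> closed_segment (half_turn c a) (half_turn c b)"
proof clarify
  fix x assume "x \<in> closed_segment a b"
  then obtain t where t: "0 \<le> t" "t \<le> 1" and x: "x = (1 - t) *\<^sub>R a + t *\<^sub>R b"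
    by (auto simp: closed_segment_def)
  have p: "0 < 1 - c \<bullet> a" "0 < 1 - c \<bullet> b" using assms inner_less_one by auto
  have xh: "x \<in> hplane"
    using x t assms hplane_convex by (auto simp: convex_alt)
  define u where "u = t * (1 - c \<bullet> b) / ((1 - t) * (1 - c \<bullet> a) + t * (1 - c \<bullet> b))"
  have "1 - c \<bullet> x = (1 - t) * (1 - c \<bullet> a) + t * (1 - c \<bullet> b)"
    by (simp add: x inner_add_right algebra_simps)
  then have pos: "(1 - t) * (1 - c \<bullet> a) + t * (1 - c \<bullet> b) > 0"
    using inner_less_one[OF assms(1) xh] by simp
  have "0 \<le> u" "u \<le> 1" using pos p t by (auto simp: u_def)
  then show "half_turn c x \<in> closed_segment (half_turn c a) (half_turn c b)"
    using half_turn_affine[of c a b t] assms xh x by (auto simp: closed_segment_def u_def)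
qed

lemma closed_segment_hplane: "a \<in> hplane \<Longrightarrow> b \<in> hplane \<Longrightarrow> closed_segment a b \<subseteq> hplane"
  by (meson closed_segment_subset hplane_convex)

text \<open>The converse inclusion is the forward one for the image points, carried back by the
  involution.\<close>

lemma half_turn_closed_segment:
  assumes "c \<in> hplane" "a \<in> hplane" "b \<in> hplane"
  shows "half_turn c ` closed_segment a b = closed_segment (half_turn c a) (half_turn c b)"
proof
  let ?h = "half_turn c"
  have "?h ` closed_segment (?h a) (?h b) \<subseteq> closed_segment a b"
    using half_turn_closed_segment_subset[of c "?h a" "?h b"] assms
    by (simp add: half_turn_in_hplane half_turn_half_turn)
  then have "?h ` ?h ` closed_segment (?h a) (?h b) \<subseteq> ?h ` closed_segment a b" by blast
  then show "closed_segment (?h a) (?h b) \<subseteq> ?h ` closed_segment a b"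
    using half_turn_image_involution[of c "closed_segment (?h a) (?h b)"] assms
    by (simp add: closed_segment_hplane half_turn_in_hplane)
qed (rule half_turn_closed_segment_subset[OF assms])

lemma hline_iff:
  "x \<in> hline a b \<longleftrightarrow> x \<in> hplane \<and> (\<exists>t. x = (1 - t) *\<^sub>R a + t *\<^sub>R b)"
proof -
  have "(\<exists>u v. x = u *\<^sub>R a + v *\<^sub>R b \<and> u + v = 1) \<longleftrightarrow> (\<exists>t. x = (1 - t) *\<^sub>R a + t *\<^sub>R b)"
    by (metis add_diff_cancel_right' diff_add_cancel)
  then show ?thesis by (auto simp: hline_def affine_hull_2)
qed

lemma half_turn_hline_subset:
  assumes "c \<in> hplane" "a \<in> hplane" "b \<in> hplane"
  shows "half_turn c ` hline a b \<subseteq> hline (half_turn c a) (half_turn c b)"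
proof clarify
  fix x assume "x \<in> hline a b"
  then obtain t where x: "x \<in> hplane" "x = (1 - t) *\<^sub>R a + t *\<^sub>R b"
    by (auto simp: hline_iff)
  then show "half_turn c x \<in> hline (half_turn c a) (half_turn c b)"
    using half_turn_affine[of c a b t] half_turn_in_hplane[of c x] assms
    unfolding hline_iff by blast
qed

lemma hline_subset: "hline a b \<subseteq> hplane"
  by (simp add: hline_def)

lemma half_turn_hline:
  assumes "c \<in> hplane" "a \<in> hplane" "b \<in> hplane"
  shows "half_turn c ` hline a b = hline (half_turn c a) (half_turn c b)"
proof
  let ?h = "half_turn c"
  have "?h ` hline (?h a) (?h b) \<subseteq> hline a b"
    using half_turn_hline_subset[of c "?h a" "?h b"] assms
    by (simp add: half_turn_in_hplane half_turn_half_turn)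
  then have "?h ` ?h ` hline (?h a) (?h b) \<subseteq> ?h ` hline a b" by blast
  then show "hline (?h a) (?h b) \<subseteq> ?h ` hline a b"
    using half_turn_image_involution[of c "hline (?h a) (?h b)"] assms
    by (simp add: hline_subset)
qed (rule half_turn_hline_subset[OF assms])

lemma half_turn_hdist:
  assumes "c \<in> hplane" "x \<in> hplane" "y \<in> hplane"
  shows "hdist (half_turn c x) (half_turn c y) = hdist x y"
proof -
  define s a b where "s = 1 - c \<bullet> c" and "a = 1 - c \<bullet> x" and "b = 1 - c \<bullet> y"
  have "0 < s" "0 < a" "0 < b" "0 < 1 - x \<bullet> x" "0 < 1 - y \<bullet> y"
    using assms inner_less_one by (auto simp: s_def a_def b_def)
  moreover define u w where "u = 1 - x \<bullet> x" and "w = 1 - y \<bullet> y"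
  ultimately have "s * (1 - x \<bullet> y) / (a * b) / (sqrt (s * u / (a * a)) * sqrt (s * w / (b * b)))
    = (1 - x \<bullet> y) / (sqrt u * sqrt w)"
  proof -
    have e: "(sqrt s * sqrt u) * (sqrt s * sqrt w) = s * (sqrt u * sqrt w)"
      using \<open>0 < s\<close> by (simp add: mult.assoc mult.left_commute flip: power2_eq_square)
    show ?thesis
      using \<open>0 < s\<close> \<open>0 < a\<close> \<open>0 < b\<close> by (simp add: real_sqrt_mult real_sqrt_divide e)
  qed
  then show ?thesis
    by (simp add: hdist_def power2_norm_eq_inner one_minus_inner_half_turn assms s_def a_def b_def u_def w_def)
qed

text \<open>Chords are transported only up to positive factors: \<open>hinner\<close> is multiplied
  by \<open>(1 - c \<bullet> x)^2 / ((1 - c \<bullet> y) * (1 - c \<bullet> z))\<close>. This splits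
  into one factor per chord and cancels in the normalised quotient.\<close>

lemma half_turn_hangle:
  assumes c: "c \<in> hplane" and x: "x \<in> hplane" and y: "y \<in> hplane" and z: "z \<in> hplane"
  shows "hangle (half_turn c x) (half_turn c y - half_turn c x) (half_turn c z - half_turn c x)
    = hangle x (y - x) (z - x)"
proof -
  let ?h = "half_turn c" and ?l = "\<lambda>x. 1 - c \<bullet> x"
  define s where "s = 1 - c \<bullet> c"
  have s: "0 < s" using c by (simp add: s_def hplane_iff_inner)
  have l: "0 < ?l x" and A: "0 < 1 - x \<bullet> x" using c x inner_less_one by auto
  have *: "hinner (?h x) (?h y - ?h x) (?h z - ?h x)
    = ((?l x)\<^sup>2 / (?l y * ?l z)) * hinner x (y - x) (z - x)"
    if y: "y \<in> hplane" and z: "z \<in> hplane" for y z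
  proof -
    define a p q B X Y Z where "a = ?l x" and "p = ?l y" and "q = ?l z"
      and "B = 1 - x \<bullet> x" and "X = 1 - x \<bullet> y" and "Y = 1 - x \<bullet> z" and "Z = 1 - y \<bullet> z"
    have pos: "0 < a" "0 < p" "0 < q" "0 < B"
      using c x y z inner_less_one by (auto simp: a_def p_def q_def B_def)
    have "((s * X / (a * p)) * (s * Y / (a * q)) - (s * B / (a * a)) * (s * Z / (p * q)))
        / (s * B / (a * a))\<^sup>2 = (a\<^sup>2 / (p * q)) * ((X * Y - B * Z) / B\<^sup>2)"
    proof -
      have "(s * X / (a * p)) * (s * Y / (a * q)) - (s * B / (a * a)) * (s * Z / (p * q))
        = s\<^sup>2 / (a\<^sup>2 * (p * q)) * (X * Y - B * Z)"
        using pos s by (simp add: field_simps power2_eq_square)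
      moreover have "(s * B / (a * a))\<^sup>2 = s\<^sup>2 * B\<^sup>2 / (a\<^sup>2 * a\<^sup>2)"
        by (simp add: power_divide power_mult_distrib power2_eq_square)
      ultimately show ?thesis using pos s by (simp add: power4_eq_xxxx power2_eq_square mult_ac)
    qed
    then show ?thesis
      unfolding hinner_chords
      by (simp add: one_minus_inner_half_turn c x y z s_def a_def p_def q_def B_def X_def Y_def Z_def)
  qed
  have p: "0 < ?l y" "0 < ?l z" using c y z inner_less_one by auto
  have e: "sqrt ((?l x)\<^sup>2 / (?l y * ?l y) * hinner x (y - x) (y - x))
      * sqrt ((?l x)\<^sup>2 / (?l z * ?l z) * hinner x (z - x) (z - x))
    = ((?l x)\<^sup>2 / (?l y * ?l z)) * (sqrt (hinner x (y - x) (y - x)) * sqrt (hinner x (z - x) (z - x)))"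
    using p l by (simp add: real_sqrt_mult real_sqrt_divide power2_eq_square)
  show ?thesis
    unfolding hangle_def *[OF y z] *[OF y y] *[OF z z] e
    using p l by (subst mult_divide_mult_cancel_left) auto
qed

section \<open>Hyperbolic area\<close>

lemma measurable_vec2 [measurable]:
  "(\<lambda>(x, y). vector [x, y] :: real^2) \<in> borel_measurable borel"
proof -
  have "(\<lambda>(x, y). vector [x, y] :: real^2) = (\<lambda>p. fst p *\<^sub>R axis 1 1 + snd p *\<^sub>R axis 2 1)"
    by (auto simp: fun_eq_iff vec_eq_iff forall_2 axis_def)
  then show ?thesis
    by (simp only:) (intro borel_measurable_continuous_onI continuous_intros)
qed

text \<open>Transfers iterated integration from pairs to \<open>real^2\<close>; both measures give a
  box the product of its side lengths.\<close>

lemma lborel_vec2: "distr (lborel :: (real \<times> real) measure) borel (\<lambda>(x, y). vector [x, y]) = (lborel :: (real^2) measure)"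
proof (rule lborel_eqI[symmetric])
  fix l u :: "real^2" assume lu: "\<And>b. b \<in> Basis \<Longrightarrow> l \<bullet> b \<le> u \<bullet> b"
  have lu1: "l $ 1 \<le> u $ 1" and lu2: "l $ 2 \<le> u $ 2"
    using lu[of "axis 1 1"] lu[of "axis 2 1"] by (auto simp: inner_axis axis_in_Basis_iff)
  have "(\<lambda>(x, y). vector [x, y] :: real^2) -` box l u = box (l $ 1) (u $ 1) \<times> box (l $ 2) (u $ 2)"
    by (auto simp: mem_box_cart forall_2)
  then have "emeasure (distr (lborel :: (real \<times> real) measure) borel (\<lambda>(x, y). vector [x, y])) (box l u)
    = emeasure (lborel \<Otimes>\<^sub>M lborel) (box (l $ 1) (u $ 1) \<times> box (l $ 2) (u $ 2))"
    by (subst emeasure_distr) (auto simp: lborel_prod)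
  also have "\<dots> = ennreal (u $ 1 - l $ 1) * ennreal (u $ 2 - l $ 2)"
    by (subst lborel.emeasure_pair_measure_Times) (use lu1 lu2 in auto)
  also have "\<dots> = (\<Prod>b\<in>Basis. (u - l) \<bullet> b)"
    using lu1 lu2 by (simp add: Basis_vec_def axis_eq_axis prod.UNION_disjoint UNIV_2 inner_axis mult.commute flip: ennreal_mult)
  finally show "emeasure (distr lborel borel (\<lambda>(x, y). vector [x, y])) (box l u) = (\<Prod>b\<in>Basis. (u - l) \<bullet> b)" .
qed simp

lemma nn_integral_vec2:
  assumes [measurable]: "f \<in> borel_measurable (borel :: (real^2) measure)"
  shows "(\<integral>\<^sup>+z. f z \<partial>lborel) = (\<integral>\<^sup>+x. \<integral>\<^sup>+y. f (vector [x, y]) \<partial>lborel \<partial>lborel)"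
proof -
  have "(\<integral>\<^sup>+z. f z \<partial>lborel) = (\<integral>\<^sup>+p. f (case p of (x, y) \<Rightarrow> vector [x, y]) \<partial>lborel)"
    unfolding lborel_vec2[symmetric] by (subst nn_integral_distr) auto
  also have "\<dots> = (\<integral>\<^sup>+p. f (case p of (x, y) \<Rightarrow> vector [x, y]) \<partial>(lborel \<Otimes>\<^sub>M lborel))"
    by (simp add: lborel_prod)
  also have "\<dots> = (\<integral>\<^sup>+x. \<integral>\<^sup>+y. f (vector [x, y]) \<partial>lborel \<partial>lborel)"
    by (subst lborel.nn_integral_fst[symmetric]) (auto simp: lborel_prod)
  finally show ?thesis .
qed

section \<open>Change of variables for the hyperbolic area\<close>

abbreviation hdensity :: "real^2 \<Rightarrow> real" where
  "hdensity x \<equiv> 1 / (1 - (norm x)\<^sup>2) powr (3/2)"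

lemma continuous_on_hdensity: "S \<subseteq> hplane \<Longrightarrow> continuous_on S hdensity"
  by (intro continuous_intros) (auto simp: hplane_iff_inner power2_norm_eq_inner subset_iff)

text \<open>Passes from the Lebesgue integral to the gauge integral, for which change of variables
  and additivity over almost disjoint pieces are applied.\<close>

lemma harea_eq_integral:
  assumes "compact S" "S \<subseteq> hplane"
  shows "harea S = integral S hdensity" "hdensity absolutely_integrable_on S"
proof -
  have i: "set_integrable lborel S hdensity"
    using borel_integrable_compact[OF assms(1) continuous_on_hdensity[OF assms(2)]]
    by (simp add: set_integrable_def)
  then show "harea S = integral S hdensity"
    unfolding harea_def by (rule set_borel_integral_eq_integral(2))
  show "hdensity absolutely_integrable_on S"
    using i integrable_completion[OF borel_measurable_integrable] unfolding set_integrable_def by blast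
qed

lemma harea_image:
  assumes S: "compact S" "S \<subseteq> hplane" and gS: "g ` S \<subseteq> hplane" and inj: "inj_on g S"
    and der: "\<And>x. x \<in> S \<Longrightarrow> (g has_derivative g' x) (at x)"
    and det: "\<And>x. x \<in> S \<Longrightarrow> \<bar>det (matrix (g' x))\<bar> * hdensity (g x) = hdensity x"
  shows "harea (g ` S) = harea S"
proof -
  have der': "\<And>x. x \<in> S \<Longrightarrow> (g has_derivative g' x) (at x within S)"
    using der has_derivative_at_withinI by blast
  have cg: "compact (g ` S)"
    using S(1) der' by (intro compact_continuous_image) (auto intro: has_derivative_continuous_on)
  \<comment> \<open>The change of variables theorem applied here concerns functions into a Cartesian
    space, so the density is wrapped into \<open>real^1\<close>.\<close>
  define F :: "real^2 \<Rightarrow> real^1" where "F x = vec (hdensity x)" for x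
  have vec_scale: "c *\<^sub>R vec a = (vec (c * a) :: real^1)" for c a :: real
    by (simp add: vec_eq_iff)
  have bl: "bounded_linear (vec :: real \<Rightarrow> real^1)"
    by (intro bounded_linear_intro[where K=1]) (auto simp: vec_eq_iff norm_vec_def L2_set_def)
  have F: "F absolutely_integrable_on T \<and> integral T F = vec (harea T)" if "compact T" "T \<subseteq> hplane" for T
  proof -
    note i = harea_eq_integral(2)[OF that]
    show ?thesis
      using absolutely_integrable_linear[OF i bl] integral_linear[OF set_lebesgue_integral_eq_integral(1)[OF i] bl]
      by (simp add: F_def[abs_def] o_def harea_eq_integral(1)[OF that])
  qed
  have "((\<lambda>x. \<bar>det (matrix (g' x))\<bar> *\<^sub>R F (g x)) absolutely_integrable_on S \<and>
      integral S (\<lambda>x. \<bar>det (matrix (g' x))\<bar> *\<^sub>R F (g x)) = vec (harea (g ` S)))"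
    using has_absolute_integral_change_of_variables_compact[where f=F, OF S(1) der' inj] F[OF cg gS] by blast
  moreover have "integral S (\<lambda>x. \<bar>det (matrix (g' x))\<bar> *\<^sub>R F (g x)) = integral S F"
    by (rule integral_cong) (simp only: F_def vec_scale det)
  moreover have "integral S F = vec (harea S)" using F[OF S] by blast
  ultimately have "vec (harea (g ` S)) = (vec (harea S) :: real^1)" by simp
  then show ?thesis by (simp add: vec_eq_iff)
qed

lemma det_matrix_2:
  fixes f :: "real^2 \<Rightarrow> real^2"
  shows "det (matrix f) = f (axis 1 1) $ 1 * f (axis 2 1) $ 2 - f (axis 2 1) $ 1 * f (axis 1 1) $ 2"
  by (simp add: det_2 matrix_def)

lemma inner_vec_2: "x \<bullet> y = x $ 1 * y $ 1 + x $ 2 * y $ 2" for x y :: "real^2"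
  by (simp add: inner_vec_def sum_2)

text \<open>The quotient rule is regrouped as a scalar times the identity plus a rank-one map, the
  shape whose determinant is immediate.\<close>

lemma half_turn_has_derivative:
  assumes c: "c \<in> hplane" and x: "x \<in> hplane"
  defines "s \<equiv> sqrt (1 - c \<bullet> c)" and "l \<equiv> 1 - c \<bullet> x"
  shows "(half_turn c has_derivative
    (\<lambda>h. (- s / l) *\<^sub>R (h + (c \<bullet> h) *\<^sub>R ((1 / (s * (1 + s))) *\<^sub>R c - (1 / s) *\<^sub>R half_turn c x)))) (at x)"
proof -
  have s: "s > 0" and l: "l > 0" using c x by (auto simp: s_def l_def hplane_iff_inner inner_less_one)
  have "(half_turn c has_derivative
    (\<lambda>h. (1 / l) *\<^sub>R (- s *\<^sub>R h - (c \<bullet> h / (1 + s)) *\<^sub>R c)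
      + ((c \<bullet> h) / l\<^sup>2) *\<^sub>R (c - s *\<^sub>R x - (c \<bullet> x / (1 + s)) *\<^sub>R c))) (at x)"
    unfolding half_turn_def[abs_def] s_def[symmetric]
    using l s by (auto intro!: derivative_eq_intros simp: l_def power2_eq_square divide_simps)
  moreover have "(1 / l) *\<^sub>R (- s *\<^sub>R h - (c \<bullet> h / (1 + s)) *\<^sub>R c)
      + ((c \<bullet> h) / l\<^sup>2) *\<^sub>R (c - s *\<^sub>R x - (c \<bullet> x / (1 + s)) *\<^sub>R c)
    = (- s / l) *\<^sub>R (h + (c \<bullet> h) *\<^sub>R ((1 / (s * (1 + s))) *\<^sub>R c - (1 / s) *\<^sub>R half_turn c x))" for h
  proof -
    define N where "N = c - s *\<^sub>R x - (c \<bullet> x / (1 + s)) *\<^sub>R c"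
    have "half_turn c x = (1 / l) *\<^sub>R N" by (simp add: half_turn_def N_def s_def l_def)
    then show ?thesis unfolding N_def[symmetric]
      using s l by (simp add: scaleR_add_right scaleR_diff_right power2_eq_square)
  qed
  ultimately show ?thesis by simp
qed

text \<open>By the rank-one formula the determinant is
  \<open>(s / l)^2 * (1 + c \<bullet> w)\<close>, and
  \<open>1 - c \<bullet> half_turn c x = s^2 / l\<close> turns the last factor into a third
  \<open>s / l\<close>.\<close>

lemma half_turn_det:
  assumes c: "c \<in> hplane" and x: "x \<in> hplane"
  defines "s \<equiv> sqrt (1 - c \<bullet> c)" and "l \<equiv> 1 - c \<bullet> x"
  shows "det (matrix (\<lambda>h. (- s / l) *\<^sub>R (h + (c \<bullet> h) *\<^sub>R ((1 / (s * (1 + s))) *\<^sub>R c - (1 / s) *\<^sub>R half_turn c x))))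
    = (s / l) ^ 3"
proof -
  have s: "s > 0" and l: "l > 0" and cc: "c \<bullet> c = 1 - s\<^sup>2"
    using c x by (auto simp: s_def l_def hplane_iff_inner inner_less_one)
  define w where "w = (1 / (s * (1 + s))) *\<^sub>R c - (1 / s) *\<^sub>R half_turn c x"
  have "1 - c \<bullet> half_turn c x = s\<^sup>2 / l"
    using one_minus_inner_half_turn[OF c _ x, of 0] by (simp add: hplane_def cc l_def)
  then have "c \<bullet> w = (1 - s\<^sup>2) / (s * (1 + s)) - (1 - s\<^sup>2 / l) / s"
    by (simp add: w_def inner_diff_right cc algebra_simps)
  also have "(1 - s\<^sup>2) / (s * (1 + s)) = 1 / s - 1"
  proof -
    have "1 - s\<^sup>2 = (1 - s) * (1 + s)" by (simp add: algebra_simps power2_eq_square)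
    then show ?thesis using s by (simp add: diff_divide_distrib)
  qed
  finally have cw: "1 + c \<bullet> w = s / l"
    using s by (simp add: diff_divide_distrib power2_eq_square)
  have "det (matrix (\<lambda>h. (- s / l) *\<^sub>R (h + (c \<bullet> h) *\<^sub>R w))) = (s / l)\<^sup>2 * (1 + c \<bullet> w)"
    by (simp add: det_matrix_2 inner_vec_2 axis_def algebra_simps power2_eq_square)
  also have "\<dots> = (s / l) ^ 3"
    by (simp only: cw power3_eq_cube power2_eq_square)
  finally show ?thesis unfolding w_def .
qed

text \<open>The exponent 3/2 of the density matches the Jacobian: \<open>1 - x \<bullet> x\<close>
  is multiplied by \<open>(s / l)^2\<close>, and the Jacobian is \<open>(s / l)^3\<close>.\<close>

lemma harea_half_turn:
  assumes c: "c \<in> hplane" and S: "compact S" "S \<subseteq> hplane"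
  shows "harea (half_turn c ` S) = harea S"
proof (rule harea_image[OF S half_turn_image_hplane_subset[OF c S(2)] inj_on_half_turn[OF c S(2)]])
  fix x assume "x \<in> S"
  then have x: "x \<in> hplane" using S by blast
  show "(half_turn c has_derivative (\<lambda>h. (- sqrt (1 - c \<bullet> c) / (1 - c \<bullet> x)) *\<^sub>R (h + (c \<bullet> h) *\<^sub>R
      ((1 / (sqrt (1 - c \<bullet> c) * (1 + sqrt (1 - c \<bullet> c)))) *\<^sub>R c - (1 / sqrt (1 - c \<bullet> c)) *\<^sub>R half_turn c x)))) (at x)"
    by (rule half_turn_has_derivative[OF c x])
  define s l where "s = sqrt (1 - c \<bullet> c)" and "l = 1 - c \<bullet> x"
  have s: "s > 0" and l: "l > 0" and cc: "c \<bullet> c = 1 - s\<^sup>2"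
    using c x by (auto simp: s_def l_def hplane_iff_inner inner_less_one)
  define B where "B = 1 - x \<bullet> x"
  have B: "B > 0" using x by (simp add: B_def hplane_iff_inner)
  have "((s / l)\<^sup>2 * B) powr (3/2) = ((s / l)\<^sup>2) powr (3/2) * B powr (3/2)"
    using s l B by (simp add: powr_mult)
  also have "((s / l)\<^sup>2) powr (3/2) = (s / l) ^ 3"
    using s l by (simp add: powr_powr flip: powr_numeral)
  finally have "(s / l) ^ 3 * (1 / ((s / l)\<^sup>2 * B) powr (3/2)) = 1 / B powr (3/2)"
    using s l B by simp
  moreover have "1 - half_turn c x \<bullet> half_turn c x = (s / l)\<^sup>2 * B"
    using one_minus_inner_half_turn[OF c x x] by (simp add: cc l_def B_def power2_eq_square)
  ultimately show "\<bar>det (matrix (\<lambda>h. (- sqrt (1 - c \<bullet> c) / (1 - c \<bullet> x)) *\<^sub>R (h + (c \<bullet> h) *\<^sub>R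
      ((1 / (sqrt (1 - c \<bullet> c) * (1 + sqrt (1 - c \<bullet> c)))) *\<^sub>R c - (1 / sqrt (1 - c \<bullet> c)) *\<^sub>R half_turn c x))))\<bar>
      * hdensity (half_turn c x) = hdensity x"
    using half_turn_det[OF c x] s l
    by (simp add: power2_norm_eq_inner s_def l_def B_def)
qed

lemma harea_orthonormal_image:
  fixes e f :: "real^2"
  assumes e: "e \<bullet> e = 1" and f: "f \<bullet> f = 1" and ef: "e \<bullet> f = 0"
    and S: "compact S" "S \<subseteq> hplane"
  shows "harea ((\<lambda>z. z $ 1 *\<^sub>R e + z $ 2 *\<^sub>R f) ` S) = harea S"
proof (rule harea_image[OF S])
  let ?L = "\<lambda>z :: real^2. z $ 1 *\<^sub>R e + z $ 2 *\<^sub>R f"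
  have n: "?L z \<bullet> ?L z = z \<bullet> z" for z
    by (simp add: inner_add_left inner_add_right e f ef inner_commute[of f e] inner_vec_2[of z z])
  show "?L ` S \<subseteq> hplane" using S(2) n by (auto simp: hplane_iff_inner)
  have d: "?L y - ?L z = ?L (y - z)" for y z by (simp add: algebra_simps)
  show "inj_on ?L S"
    by (rule inj_onI) (metis d n eq_iff_diff_eq_0 inner_eq_zero_iff)
  show "(?L has_derivative ?L) (at x)" for x
    by (intro derivative_intros bounded_linear_imp_has_derivative bounded_linear_vec_nth)
  \<comment> \<open>The square of the determinant is the Gram determinant of \<open>e\<close> and
    \<open>f\<close>, so rotations and reflections are covered alike.\<close>
  have "(det (matrix ?L))\<^sup>2 = (e \<bullet> e) * (f \<bullet> f) - (e \<bullet> f)\<^sup>2"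
    by (simp add: det_matrix_2 axis_def inner_vec_2 algebra_simps power2_eq_square)
  then have "\<bar>det (matrix ?L)\<bar> = 1"
    by (auto simp: e f ef power2_eq_1_iff)
  then show "\<bar>det (matrix ?L)\<bar> * hdensity (?L x) = hdensity x" for x
    by (simp add: power2_norm_eq_inner n del: inner_add_left inner_add_right)
qed

section \<open>Area of a triangle with apex at the centre of the disc\<close>

lemma hdensity_vec2_inner_integral:
  assumes x: "0 \<le> x" and k1: "k1 > 0" and k2: "k2 > 0"
    and w1: "(1 + k1\<^sup>2) * x\<^sup>2 < 1" and w2: "(1 + k2\<^sup>2) * x\<^sup>2 < 1"
  shows "(\<integral>\<^sup>+y. ennreal (hdensity (vector [x, y])) * indicator {- k1 * x..k2 * x} y \<partial>lborel)
    = ennreal (k1 * x / ((1 - x\<^sup>2) * sqrt (1 - (1 + k1\<^sup>2) * x\<^sup>2)) + k2 * x / ((1 - x\<^sup>2) * sqrt (1 - (1 + k2\<^sup>2) * x\<^sup>2)))"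
proof -
  have n: "(norm (vector [x, y] :: real^2))\<^sup>2 = x\<^sup>2 + y\<^sup>2" for y
    by (simp only: power2_norm_eq_inner inner_vec_2 vector_2) (simp add: power2_eq_square)
  \<comment> \<open>An antiderivative in \<open>y\<close> of the density; it is odd, so the two ends
    of the slice contribute summands of the same form.\<close>
  let ?F = "\<lambda>y. y / ((1 - x\<^sup>2) * sqrt (1 - x\<^sup>2 - y\<^sup>2))"
  have "x\<^sup>2 \<le> (1 + k1\<^sup>2) * x\<^sup>2" by (simp add: algebra_simps)
  then have x1: "0 < 1 - x\<^sup>2" using w1 by linarith
  have "(\<integral>\<^sup>+y. ennreal (hdensity (vector [x, y])) * indicator {- k1 * x..k2 * x} y \<partial>lborel)
    = ennreal (?F (k2 * x) - ?F (- k1 * x))"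
  proof (rule nn_integral_FTC_Icc)
    show "- k1 * x \<le> k2 * x" using x k1 k2 by (intro mult_right_mono) auto
    show "(\<lambda>y. hdensity (vector [x, y])) \<in> borel_measurable borel"
      unfolding n by measurable
    fix y assume "y \<in> {- k1 * x..k2 * x}"
    then have y: "- k1 * x \<le> y" "y \<le> k2 * x" by auto
    have "y\<^sup>2 \<le> (k1\<^sup>2 * x\<^sup>2) \<or> y\<^sup>2 \<le> (k2\<^sup>2 * x\<^sup>2)"
    proof (cases "y \<ge> 0")
      case True
      then have "y\<^sup>2 \<le> (k2 * x)\<^sup>2" using y by (intro power_mono) auto
      then show ?thesis by (simp add: power_mult_distrib)
    next
      case False
      then have "(- y)\<^sup>2 \<le> (k1 * x)\<^sup>2" using y by (intro power_mono) auto
      then show ?thesis by (simp add: power_mult_distrib)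
    qed
    then have "0 < 1 - x\<^sup>2 - y\<^sup>2" using w1 w2 by (auto simp: algebra_simps)
    moreover define w where "w = 1 - x\<^sup>2 - y\<^sup>2"
    ultimately have w: "w > 0" and yw: "y\<^sup>2 = 1 - x\<^sup>2 - w" by auto
    have "(?F has_real_derivative ((1 - x\<^sup>2) * sqrt w + y\<^sup>2 * (1 - x\<^sup>2) / sqrt w) / ((1 - x\<^sup>2) * sqrt w)\<^sup>2) (at y)"
      using x1 w unfolding w_def
      by (auto intro!: derivative_eq_intros simp: power2_eq_square divide_simps)
    moreover have "((1 - x\<^sup>2) * sqrt w + y\<^sup>2 * (1 - x\<^sup>2) / sqrt w) / ((1 - x\<^sup>2) * sqrt w)\<^sup>2
      = 1 / w powr (3/2)"
    proof -
      have p: "w powr (3/2) = w * sqrt w"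
      proof -
        have "w powr (3/2) = w powr (1 + 1/2)" by simp
        also have "\<dots> = w * sqrt w" using w by (subst powr_add) (simp add: powr_half_sqrt)
        finally show ?thesis .
      qed
      have "(1 - x\<^sup>2) * sqrt w + y\<^sup>2 * (1 - x\<^sup>2) / sqrt w = (1 - x\<^sup>2) * (sqrt w * sqrt w + y\<^sup>2) / sqrt w"
        using w by (simp add: field_simps)
      also have "sqrt w * sqrt w + y\<^sup>2 = 1 - x\<^sup>2" using w yw by simp
      finally show ?thesis
        unfolding p using x1 w by (simp add: power2_eq_square mult_ac)
    qed
    ultimately show "(?F has_real_derivative hdensity (vector [x, y])) (at y)"
      unfolding n by (simp add: w_def algebra_simps)
  qed simp
  also have "?F (k2 * x) - ?F (- k1 * x) = k1 * x / ((1 - x\<^sup>2) * sqrt (1 - (1 + k1\<^sup>2) * x\<^sup>2)) + k2 * x / ((1 - x\<^sup>2) * sqrt (1 - (1 + k2\<^sup>2) * x\<^sup>2))"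
    by (simp add: power_mult_distrib algebra_simps)
  finally show ?thesis .
qed

text \<open>The outer integration of one such summand: with \<open>w\<close> the root,
  \<open>1 + (w / k)^2\<close> contains the factor \<open>1 - x^2\<close>, which is the denominator
  left by the inner integration.\<close>

lemma arctan_slice_derivative:
  fixes k x :: real
  assumes k: "k > 0" and w: "(1 + k\<^sup>2) * x\<^sup>2 < 1"
  shows "((\<lambda>x. - arctan (sqrt (1 - (1 + k\<^sup>2) * x\<^sup>2) / k)) has_real_derivative
    k * x / ((1 - x\<^sup>2) * sqrt (1 - (1 + k\<^sup>2) * x\<^sup>2))) (at x)"
proof -
  define w where "w = sqrt (1 - (1 + k\<^sup>2) * x\<^sup>2)"
  have w0: "w > 0" using assms by (simp add: w_def)
  have w2: "w\<^sup>2 = 1 - (1 + k\<^sup>2) * x\<^sup>2" using assms by (simp add: w_def)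
  have "x\<^sup>2 \<le> (1 + k\<^sup>2) * x\<^sup>2" by (simp add: algebra_simps)
  then have x1: "0 < 1 - x\<^sup>2" using assms by linarith
  have "((\<lambda>x. - arctan (sqrt (1 - (1 + k\<^sup>2) * x\<^sup>2) / k)) has_real_derivative
    inverse (1 + (w / k)\<^sup>2) * ((1 + k\<^sup>2) * x / (w * k))) (at x)"
    using assms w0 unfolding w_def
    by (auto intro!: derivative_eq_intros simp: divide_simps)
  moreover have "inverse (1 + (w / k)\<^sup>2) * ((1 + k\<^sup>2) * x / (w * k)) = k * x / ((1 - x\<^sup>2) * w)"
  proof -
    have "1 + (w / k)\<^sup>2 = (1 + k\<^sup>2) * (1 - x\<^sup>2) / k\<^sup>2"
      using k by (simp add: power_divide w2 field_simps)
    moreover have "1 + k\<^sup>2 \<noteq> 0" by (metis add_pos_nonneg less_irrefl zero_less_one zero_le_power2)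
    ultimately show ?thesis using k x1 w0 by (simp add: power2_eq_square)
  qed
  ultimately show ?thesis by (simp add: w_def)
qed

text \<open>The triangle formed by the centre and a side tangent at \<open>(q, 0)\<close>;
  \<open>k1\<close> and \<open>k2\<close> are the tangents of the angles between the first axis and
  the rays to the two ends of the side.\<close>

definition cone_triangle :: "real \<Rightarrow> real \<Rightarrow> real \<Rightarrow> (real^2) set" where
  "cone_triangle q k1 k2 = {z. 0 \<le> z $ 1 \<and> z $ 1 \<le> q \<and> - k1 * z $ 1 \<le> z $ 2 \<and> z $ 2 \<le> k2 * z $ 1}"

lemma cone_triangle_subset_hplane:
  assumes "q > 0" "k1 > 0" "k2 > 0" "(1 + k1\<^sup>2) * q\<^sup>2 < 1" "(1 + k2\<^sup>2) * q\<^sup>2 < 1"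
  shows "cone_triangle q k1 k2 \<subseteq> hplane"
proof
  fix z assume "z \<in> cone_triangle q k1 k2"
  then have z: "0 \<le> z $ 1" "z $ 1 \<le> q" "- k1 * z $ 1 \<le> z $ 2" "z $ 2 \<le> k2 * z $ 1"
    by (auto simp: cone_triangle_def)
  define k where "k = max k1 k2"
  have "\<bar>z $ 2\<bar> \<le> k * q"
  proof -
    have "k1 * z $ 1 \<le> k * q" "k2 * z $ 1 \<le> k * q"
      using z assms by (auto simp: k_def intro!: mult_mono)
    then show ?thesis using z by linarith
  qed
  then have "(z $ 2)\<^sup>2 \<le> (k * q)\<^sup>2" by (metis abs_ge_zero power2_abs power_mono)
  moreover have "(z $ 1)\<^sup>2 \<le> q\<^sup>2" using z by (intro power_mono) auto
  ultimately have "(z $ 1)\<^sup>2 + (z $ 2)\<^sup>2 \<le> (1 + k\<^sup>2) * q\<^sup>2"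
    by (simp add: algebra_simps power_mult_distrib)
  also have "\<dots> < 1" using assms by (auto simp: k_def max_def)
  finally show "z \<in> hplane" by (simp add: hplane_iff_inner inner_vec_2 power2_eq_square)
qed

lemma compact_cone_triangle:
  assumes "q > 0" "k1 > 0" "k2 > 0" "(1 + k1\<^sup>2) * q\<^sup>2 < 1" "(1 + k2\<^sup>2) * q\<^sup>2 < 1"
  shows "compact (cone_triangle q k1 k2)"
proof -
  have "closed (cone_triangle q k1 k2)"
    unfolding cone_triangle_def by (intro closed_Collect_conj closed_Collect_le continuous_intros)
  moreover have "bounded (cone_triangle q k1 k2)"
    using cone_triangle_subset_hplane[OF assms] bounded_subset[of hplane] by (simp add: hplane_def)
  ultimately show ?thesis by (simp add: compact_eq_bounded_closed)
qed

lemma harea_cone_triangle: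
  assumes q: "q > 0" and k1: "k1 > 0" and k2: "k2 > 0"
    and w1: "(1 + k1\<^sup>2) * q\<^sup>2 < 1" and w2: "(1 + k2\<^sup>2) * q\<^sup>2 < 1"
  shows "harea (cone_triangle q k1 k2) =
    (arctan (1 / k1) - arctan (sqrt (1 - (1 + k1\<^sup>2) * q\<^sup>2) / k1))
    + (arctan (1 / k2) - arctan (sqrt (1 - (1 + k2\<^sup>2) * q\<^sup>2) / k2))"
proof -
  let ?T = "cone_triangle q k1 k2"
  let ?H = "\<lambda>x. k1 * x / ((1 - x\<^sup>2) * sqrt (1 - (1 + k1\<^sup>2) * x\<^sup>2)) + k2 * x / ((1 - x\<^sup>2) * sqrt (1 - (1 + k2\<^sup>2) * x\<^sup>2))"
  let ?A = "\<lambda>k x. - arctan (sqrt (1 - (1 + k\<^sup>2) * x\<^sup>2) / k)"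
  have mono: "(1 + k\<^sup>2) * x\<^sup>2 < 1" if "(1 + k\<^sup>2) * q\<^sup>2 < 1" "0 \<le> x" "x \<le> q" for k x :: real
  proof -
    have "x\<^sup>2 \<le> q\<^sup>2" using that by (intro power_mono) auto
    then have "(1 + k\<^sup>2) * x\<^sup>2 \<le> (1 + k\<^sup>2) * q\<^sup>2" by (intro mult_left_mono) auto
    then show ?thesis using that by linarith
  qed
  have hm [measurable]: "hdensity \<in> borel_measurable borel" by measurable
  have [measurable]: "?T \<in> sets borel"
    by (intro borel_closed compact_imp_closed compact_cone_triangle assms)
  have "(\<integral>\<^sup>+z. ennreal (indicator ?T z *\<^sub>R hdensity z) \<partial>lborel)
    = (\<integral>\<^sup>+x. \<integral>\<^sup>+y. ennreal (indicator ?T (vector [x, y]) *\<^sub>R hdensity (vector [x, y])) \<partial>lborel \<partial>lborel)"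
    by (rule nn_integral_vec2) measurable
  also have "\<dots> = (\<integral>\<^sup>+x. ennreal (?H x) * indicator {0..q} x \<partial>lborel)"
  proof (rule nn_integral_cong)
    fix x :: real
    show "(\<integral>\<^sup>+y. ennreal (indicator ?T (vector [x, y]) *\<^sub>R hdensity (vector [x, y])) \<partial>lborel)
      = ennreal (?H x) * indicator {0..q} x"
    proof (cases "0 \<le> x \<and> x \<le> q")
      case True
      have "(\<integral>\<^sup>+y. ennreal (indicator ?T (vector [x, y]) *\<^sub>R hdensity (vector [x, y])) \<partial>lborel)
        = (\<integral>\<^sup>+y. ennreal (hdensity (vector [x, y])) * indicator {- k1 * x..k2 * x} y \<partial>lborel)"
        using True by (intro nn_integral_cong) (auto simp: cone_triangle_def indicator_def)
      then show ?thesis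
        using hdensity_vec2_inner_integral[of x k1 k2] True k1 k2 mono[OF w1] mono[OF w2] by simp
    next
      case False
      then show ?thesis by (auto simp: cone_triangle_def indicator_def)
    qed
  qed
  also have "\<dots> = ennreal ((?A k1 q + ?A k2 q) - (?A k1 0 + ?A k2 0))"
  proof (rule nn_integral_FTC_Icc)
    show "?H \<in> borel_measurable borel" by measurable
    show "0 \<le> q" using q by simp
    fix x assume "x \<in> {0..q}"
    then have x: "0 \<le> x" "x \<le> q" by auto
    show "((\<lambda>x. ?A k1 x + ?A k2 x) has_real_derivative ?H x) (at x)"
      using x by (intro DERIV_add arctan_slice_derivative k1 k2 mono[OF w1] mono[OF w2])
    have "x\<^sup>2 \<le> (1 + k1\<^sup>2) * x\<^sup>2" by (simp add: algebra_simps)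
    then have x1: "0 \<le> 1 - x\<^sup>2" using mono[OF w1 x] by linarith
    show "0 \<le> ?H x" using x x1 k1 k2 mono[OF w1 x] mono[OF w2 x] by (intro add_nonneg_nonneg divide_nonneg_nonneg mult_nonneg_nonneg) auto
  qed
  finally have nn: "(\<integral>\<^sup>+z. ennreal (indicator ?T z *\<^sub>R hdensity z) \<partial>lborel)
    = ennreal ((?A k1 q + ?A k2 q) - (?A k1 0 + ?A k2 0))" .
  \<comment> \<open>\<open>ennreal\<close> sends negative reals to 0, so the value of the integral
    can be read back only once it is known to be nonnegative.\<close>
  have le: "arctan (sqrt (1 - (1 + k\<^sup>2) * q\<^sup>2) / k) \<le> arctan (1 / k)" if "k > 0" for k
    using that by (intro arctan_monotone') (simp add: divide_right_mono)
  have "has_bochner_integral lborel (\<lambda>z. indicator ?T z *\<^sub>R hdensity z)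
      ((?A k1 q + ?A k2 q) - (?A k1 0 + ?A k2 0))"
    using le[OF k1] le[OF k2] nn by (intro has_bochner_integral_nn_integral) (auto simp: indicator_def)
  then show ?thesis
    unfolding harea_def set_lebesgue_integral_def by (simp add: has_bochner_integral_iff)
qed

section \<open>Polygonal chains around a circle\<close>

lemma inner_orthonormal_expansion:
  fixes e f x :: "real^2"
  assumes "e \<bullet> e = 1" "f \<bullet> f = 1" "e \<bullet> f = 0"
  shows "x = (x \<bullet> e) *\<^sub>R e + (x \<bullet> f) *\<^sub>R f"
proof -
  have ef: "pairwise orthogonal {e, f}" "0 \<notin> {e, f}" "e \<noteq> f"
    using assms by (auto simp: pairwise_def orthogonal_def inner_commute)
  have "independent {e, f}" by (rule pairwise_orthogonal_independent[OF ef(1,2)])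
  moreover have "card {e, f} = DIM(real^2)" using ef by simp
  ultimately have "UNIV \<subseteq> span {e, f}"
    by (intro card_ge_dim_independent) auto
  then have "x \<in> span {e, f}" by blast
  then obtain a b where "x - a *\<^sub>R e = b *\<^sub>R f"
    unfolding span_breakdown_eq span_singleton by auto
  then have x: "x = a *\<^sub>R e + b *\<^sub>R f" by (simp add: diff_eq_eq add.commute)
  show ?thesis
    unfolding x using assms by (simp add: inner_add_left inner_commute[of f e])
qed

lemma cos_le_cos_abs:
  assumes "0 \<le> d" "d \<le> pi" "d \<le> \<bar>x\<bar>" "\<bar>x\<bar> \<le> 2 * pi - d"
  shows "cos x \<le> cos d"
proof (cases "\<bar>x\<bar> \<le> pi")
  case True
  then have "cos \<bar>x\<bar> \<le> cos d" using assms by (intro cos_monotone_0_pi_le) auto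
  then show ?thesis by simp
next
  case False
  then have "cos (2 * pi - \<bar>x\<bar>) \<le> cos d" using assms by (intro cos_monotone_0_pi_le) auto
  then show ?thesis by simp
qed

lemma line_point_in_closed_segment:
  fixes A B :: "'a::real_vector"
  assumes "x \<le> y" "y \<le> z"
  shows "A + y *\<^sub>R B \<in> closed_segment (A + x *\<^sub>R B) (A + z *\<^sub>R B)"
proof (cases "x = z")
  case False
  then have xz: "x < z" using assms by simp
  define u where "u = (y - x) / (z - x)"
  have u: "0 \<le> u" "u \<le> 1" "x + u * (z - x) = y" using xz assms by (auto simp: u_def)
  have "(1 - u) *\<^sub>R (A + x *\<^sub>R B) + u *\<^sub>R (A + z *\<^sub>R B) = A + (x + u * (z - x)) *\<^sub>R B"
    by (simp add: algebra_simps)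
  then show ?thesis using u by (auto simp: closed_segment_def intro!: exI[of _ u])
qed (use assms in auto)

text \<open>The first arctangent is the complement of \<open>a\<close>, the second the other acute
  angle of the right triangle, so the area is its angle defect. For \<open>q = tanh r\<close> the
  factor \<open>1 / sqrt (1 - q^2)\<close> is \<open>cosh r\<close>.\<close>

lemma slice_area_closed_form:
  assumes a: "0 < a" "a < pi / 2" and q: "0 < q" "q < cos a"
  shows "arctan (1 / tan a) - arctan (sqrt (1 - (1 + (tan a)\<^sup>2) * q\<^sup>2) / tan a)
    = pi / 2 - a - arccos (sin a / sqrt (1 - q\<^sup>2))"
proof -
  have c: "0 < cos a" "0 < sin a" using a by (auto intro: cos_gt_zero_pi sin_gt_zero)
  have t: "1 + (tan a)\<^sup>2 = 1 / (cos a)\<^sup>2"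
    using c by (simp add: tan_sec inverse_eq_divide power_divide)
  have q2: "q\<^sup>2 < (cos a)\<^sup>2" using q by (intro power_strict_mono) auto
  moreover have c1: "(cos a)\<^sup>2 < 1" using c by (simp add: cos_squared_eq)
  ultimately have q1: "0 < 1 - q\<^sup>2" by linarith
  define z where "z = sin a / sqrt (1 - q\<^sup>2)"
  have z0: "0 < z" using c q1 by (simp add: z_def)
  have z2: "1 - z\<^sup>2 = ((cos a)\<^sup>2 - q\<^sup>2) / (1 - q\<^sup>2)"
    using q1 by (simp add: z_def power_divide sin_squared_eq field_simps)
  then have "0 < 1 - z\<^sup>2" using q1 q2 by simp
  then have z1: "z < 1" using z0 by (simp add: power_less_one_iff abs_square_less_1 abs_if)
  have ac: "0 < arccos z" "arccos z < pi / 2"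
    using z0 z1 arccos_lt_bounded[of z] arccos_less_arccos[of 0 z] by simp_all
  have "tan (arccos z) = sqrt (1 - z\<^sup>2) / z"
    using z0 z1 by (simp add: tan_def sin_arccos)
  also have "\<dots> = sqrt ((cos a)\<^sup>2 - q\<^sup>2) / sin a"
    unfolding z2 using q1 by (simp add: z_def real_sqrt_divide)
  also have "\<dots> = sqrt (1 - (1 + (tan a)\<^sup>2) * q\<^sup>2) / tan a"
  proof -
    have "1 - (1 + (tan a)\<^sup>2) * q\<^sup>2 = ((cos a)\<^sup>2 - q\<^sup>2) / (cos a)\<^sup>2"
      unfolding t using c by (simp add: diff_divide_distrib)
    then show ?thesis using c by (simp add: real_sqrt_divide tan_def)
  qed
  finally have 1: "arctan (sqrt (1 - (1 + (tan a)\<^sup>2) * q\<^sup>2) / tan a) = arccos z"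
    using ac arctan_tan[of "arccos z"] by simp
  have "1 / tan a = tan (pi / 2 - a)" by (simp add: tan_cot inverse_eq_divide)
  then have 2: "arctan (1 / tan a) = pi / 2 - a" using a arctan_tan[of "pi / 2 - a"] by simp
  show ?thesis unfolding 1 2 by (simp add: z_def)
qed

text \<open>The total angle after \<open>n\<close> steps is left open, so that every winding number
  can be discussed in this setting. The frame may have either orientation, which covers both senses
  of traversal.\<close>

locale tangential_fan =
  fixes f1 f2 :: "real^2" and q :: real and n :: nat and \<alpha> :: "nat \<Rightarrow> real"
  assumes f1: "f1 \<bullet> f1 = 1" and f2: "f2 \<bullet> f2 = 1" and f12: "f1 \<bullet> f2 = 0"
    and q_pos: "0 < q" and n_pos: "0 < n"
    and \<alpha>_pos: "0 < \<alpha> k" and \<alpha>_less: "\<alpha> k < pi / 2" and \<alpha>_periodic: "\<alpha> (k + n) = \<alpha> k"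
begin

definition E :: "real \<Rightarrow> real^2" where "E \<theta> = cos \<theta> *\<^sub>R f1 + sin \<theta> *\<^sub>R f2"

text \<open>The direction of vertex \<open>k\<close> as a running total of real angles, never
  reduced modulo \<open>2 * pi\<close>, so that the winding number is retained.\<close>

definition ang :: "nat \<Rightarrow> real" where "ang k = (\<Sum>j<k. \<alpha> j + \<alpha> (Suc j))"

text \<open>The direction of the tangency point of side \<open>k\<close>, between
  \<open>ang k\<close> and \<open>ang (Suc k)\<close>.\<close>

definition \<Theta> :: "nat \<Rightarrow> real" where "\<Theta> k = ang k + \<alpha> k"

definition V :: "nat \<Rightarrow> real^2" where "V k = (q / cos (\<alpha> k)) *\<^sub>R E (ang k)"

lemma f21: "f2 \<bullet> f1 = 0" using f12 by (simp add: inner_commute)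

lemma E_inner: "E \<theta> \<bullet> E \<eta> = cos (\<theta> - \<eta>)"
  by (simp add: E_def inner_add_left inner_add_right f1 f2 f12 f21 cos_diff)

lemma E_inner': "E \<eta> \<bullet> E \<theta> = cos (\<theta> - \<eta>)"
  by (simp add: E_inner cos_diff mult.commute)

lemma norm_E [simp]: "norm (E \<theta>) = 1"
  by (simp add: norm_eq_sqrt_inner E_inner)

lemma E_nonzero [simp]: "E \<theta> \<noteq> 0"
  using norm_E[of \<theta>] by fastforce

lemma E_add: "E (\<theta> + \<delta>) = cos \<delta> *\<^sub>R E \<theta> + sin \<delta> *\<^sub>R E (\<theta> + pi / 2)"
  by (simp add: E_def cos_add sin_add algebra_simps)

lemma E_orthonormal: "E \<theta> \<bullet> E \<theta> = 1" "E (\<theta> + pi / 2) \<bullet> E (\<theta> + pi / 2) = 1" "E \<theta> \<bullet> E (\<theta> + pi / 2) = 0"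
  by (auto simp: E_inner)

lemma E_eq_iff: "E \<theta> = E \<eta> \<longleftrightarrow> (\<exists>m::int. \<theta> - \<eta> = m * 2 * pi)"
proof -
  have "E \<theta> = E \<eta> \<longleftrightarrow> (E \<theta> - E \<eta>) \<bullet> (E \<theta> - E \<eta>) = 0" by simp
  also have "(E \<theta> - E \<eta>) \<bullet> (E \<theta> - E \<eta>) = 2 - 2 * cos (\<theta> - \<eta>)"
    by (simp add: inner_diff_left inner_diff_right E_inner del: inner_eq_zero_iff)
       (simp add: cos_diff)
  also have "2 - 2 * cos (\<theta> - \<eta>) = 0 \<longleftrightarrow> cos (\<theta> - \<eta>) = 1" by auto
  finally show ?thesis by (simp add: cos_one_2pi_int)
qed

lemma E_2pi: "E (\<theta> + 2 * pi) = E \<theta>"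
  by (simp add: E_def)

lemma polar:
  obtains s \<theta> where "0 \<le> s" "0 \<le> \<theta>" "\<theta> < 2 * pi" "x = s *\<^sub>R E \<theta>"
proof (cases "x = 0")
  case True
  then show ?thesis using that[of 0 0] by simp
next
  case False
  define a b where "a = x \<bullet> f1" and "b = x \<bullet> f2"
  have x: "x = a *\<^sub>R f1 + b *\<^sub>R f2"
    unfolding a_def b_def by (rule inner_orthonormal_expansion[OF f1 f2 f12])
  have "x \<bullet> x = (a *\<^sub>R f1 + b *\<^sub>R f2) \<bullet> (a *\<^sub>R f1 + b *\<^sub>R f2)"
    by (rule arg_cong2[where f=inner, OF x x])
  then have nx: "(norm x)\<^sup>2 = a\<^sup>2 + b\<^sup>2"
    unfolding power2_norm_eq_inner
    by (simp add: inner_add_left inner_add_right f1 f2 f12 f21 power2_eq_square)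
  have "(a / norm x)\<^sup>2 + (b / norm x)\<^sup>2 = 1"
    using False by (simp add: power_divide nx[symmetric] flip: add_divide_distrib)
  then obtain \<theta> where t: "0 \<le> \<theta>" "\<theta> < 2 * pi" "a / norm x = cos \<theta>" "b / norm x = sin \<theta>"
    by (rule sincos_total_2pi)
  then have "a = norm x * cos \<theta>" "b = norm x * sin \<theta>"
    using False by (auto simp: field_simps)
  then have "norm x *\<^sub>R E \<theta> = a *\<^sub>R f1 + b *\<^sub>R f2"
    by (simp add: E_def scaleR_add_right)
  with x have "x = norm x *\<^sub>R E \<theta>" by metis
  then show ?thesis using that[of "norm x" \<theta>] t by simp
qed

lemma ang_0 [simp]: "ang 0 = 0" by (simp add: ang_def)

lemma ang_Suc: "ang (Suc k) = ang k + \<alpha> k + \<alpha> (Suc k)" by (simp add: ang_def)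

lemma ang_Suc_\<Theta>: "ang (Suc k) = \<Theta> k + \<alpha> (Suc k)" by (simp add: ang_Suc \<Theta>_def)

lemma \<Theta>_Suc: "\<Theta> (Suc k) = \<Theta> k + 2 * \<alpha> (Suc k)" by (simp add: \<Theta>_def ang_Suc)

lemma ang_less_Suc: "ang k < ang (Suc k)"
  using \<alpha>_pos[of k] \<alpha>_pos[of "Suc k"] by (simp add: ang_Suc)

lemma ang_mono: "j \<le> k \<Longrightarrow> ang j \<le> ang k"
  by (rule lift_Suc_mono_le[of ang]) (simp_all add: ang_less_Suc less_imp_le)

lemma \<Theta>_mono: "j \<le> k \<Longrightarrow> \<Theta> j \<le> \<Theta> k"
  by (rule lift_Suc_mono_le[of \<Theta>]) (simp_all add: \<Theta>_Suc \<alpha>_pos less_imp_le)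

lemma ang_add_n: "ang (k + n) = ang k + ang n"
proof (induction k)
  case (Suc k)
  then show ?case using \<alpha>_periodic[of k] \<alpha>_periodic[of "Suc k"] by (simp add: ang_Suc)
qed simp

lemma \<Theta>_add_n: "\<Theta> (k + n) = \<Theta> k + ang n"
  by (simp add: \<Theta>_def ang_add_n \<alpha>_periodic)

lemma cos_\<alpha>_pos: "0 < cos (\<alpha> k)"
  using \<alpha>_pos[of k] \<alpha>_less[of k] by (intro cos_gt_zero_pi) auto

text \<open>Since \<open>ang (Suc i)\<close> is the midpoint of \<open>\<Theta> i\<close> and
  \<open>\<Theta> (Suc i)\<close>, the intervals between consecutive vertex angles are the Voronoi
  cells of the tangency angles.\<close>

lemma \<Theta>_nearest:
  assumes "ang i \<le> \<theta>" "\<theta> \<le> ang (Suc i)"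
  shows "\<bar>\<theta> - \<Theta> i\<bar> \<le> \<bar>\<theta> - \<Theta> j\<bar>"
proof (cases j i rule: linorder_cases)
  case less
  then obtain i' where i: "i = Suc i'" "j \<le> i'" by (cases i) auto
  then have "\<Theta> j \<le> \<Theta> i'" by (simp add: \<Theta>_mono)
  moreover have "\<Theta> i' + \<alpha> i = ang i" "\<Theta> i = ang i + \<alpha> i"
    by (auto simp: i ang_Suc_\<Theta> \<Theta>_def)
  ultimately show ?thesis using assms \<alpha>_pos[of i] by linarith
next
  case greater
  then have "\<Theta> (Suc i) \<le> \<Theta> j" by (simp add: \<Theta>_mono)
  moreover have "\<Theta> (Suc i) = ang (Suc i) + \<alpha> (Suc i)" "ang (Suc i) = \<Theta> i + \<alpha> (Suc i)"
    by (auto simp: ang_Suc_\<Theta> \<Theta>_def)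
  ultimately show ?thesis using assms \<alpha>_pos[of "Suc i"] by linarith
qed simp

lemma sector_angle:
  assumes "ang i \<le> \<theta>" "\<theta> \<le> ang (Suc i)"
  shows "- \<alpha> i \<le> \<theta> - \<Theta> i" "\<theta> - \<Theta> i \<le> \<alpha> (Suc i)" "\<bar>\<theta> - \<Theta> i\<bar> < pi / 2" "0 < cos (\<theta> - \<Theta> i)"
proof -
  show 1: "- \<alpha> i \<le> \<theta> - \<Theta> i" "\<theta> - \<Theta> i \<le> \<alpha> (Suc i)"
    using assms by (auto simp: ang_Suc_\<Theta>) (auto simp: \<Theta>_def)
  then show "\<bar>\<theta> - \<Theta> i\<bar> < pi / 2" using \<alpha>_less[of i] \<alpha>_less[of "Suc i"] by linarith
  then show "0 < cos (\<theta> - \<Theta> i)" by (intro cos_gt_zero_pi) linarith+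
qed

lemma E_scaled:
  assumes "cos \<delta> \<noteq> 0"
  shows "(q / cos \<delta>) *\<^sub>R E (\<theta> + \<delta>) = q *\<^sub>R E \<theta> + tan \<delta> *\<^sub>R (q *\<^sub>R E (\<theta> + pi / 2))"
  unfolding E_add[of \<theta> \<delta>] using assms by (simp add: scaleR_add_right tan_def)

lemma V_left: "V i = q *\<^sub>R E (\<Theta> i) + (- tan (\<alpha> i)) *\<^sub>R (q *\<^sub>R E (\<Theta> i + pi / 2))"
proof -
  have "V i = (q / cos (- \<alpha> i)) *\<^sub>R E (\<Theta> i + - \<alpha> i)" by (simp add: V_def \<Theta>_def)
  also have "\<dots> = q *\<^sub>R E (\<Theta> i) + tan (- \<alpha> i) *\<^sub>R (q *\<^sub>R E (\<Theta> i + pi / 2))"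
    by (rule E_scaled) (use cos_\<alpha>_pos[of i] in auto)
  finally show ?thesis by simp
qed

lemma V_right: "V (Suc i) = q *\<^sub>R E (\<Theta> i) + tan (\<alpha> (Suc i)) *\<^sub>R (q *\<^sub>R E (\<Theta> i + pi / 2))"
  unfolding V_def ang_Suc_\<Theta> by (rule E_scaled) (use cos_\<alpha>_pos[of "Suc i"] in auto)

text \<open>\<open>s * cos (\<theta> - \<Theta> i) = q\<close> is the polar equation of the tangent
  line, and \<open>tan (\<theta> - \<Theta> i)\<close> is an affine coordinate on it; monotonicity
  of \<open>tan\<close> keeps the point between the two vertices.\<close>

lemma sector_point_in_side:
  assumes "ang i \<le> \<theta>" "\<theta> \<le> ang (Suc i)"
  shows "(q / cos (\<theta> - \<Theta> i)) *\<^sub>R E \<theta> \<in> closed_segment (V i) (V (Suc i))"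
proof -
  note s = sector_angle[OF assms]
  have "(q / cos (\<theta> - \<Theta> i)) *\<^sub>R E \<theta>
    = q *\<^sub>R E (\<Theta> i) + tan (\<theta> - \<Theta> i) *\<^sub>R (q *\<^sub>R E (\<Theta> i + pi / 2))"
    using E_scaled[of "\<theta> - \<Theta> i" "\<Theta> i"] s(4) by simp
  moreover have "- tan (\<alpha> i) \<le> tan (\<theta> - \<Theta> i)"
  proof -
    have "tan (- \<alpha> i) \<le> tan (\<theta> - \<Theta> i)"
      using s \<alpha>_less[of i] by (intro tan_mono_le) linarith+
    then show ?thesis by simp
  qed
  moreover have "tan (\<theta> - \<Theta> i) \<le> tan (\<alpha> (Suc i))"
    using s \<alpha>_less[of "Suc i"] by (intro tan_mono_le) linarith+
  ultimately show ?thesis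
    unfolding V_left[of i] V_right by (simp only: line_point_in_closed_segment)
qed

lemma ex_sector:
  assumes "0 \<le> \<theta>" "\<theta> \<le> ang K" "0 < K"
  obtains i where "i < K" "ang i \<le> \<theta>" "\<theta> \<le> ang (Suc i)"
proof -
  define k where "k = (LEAST k. \<theta> \<le> ang (Suc k))"
  have K: "\<theta> \<le> ang (Suc (K - 1))" using assms by simp
  then have 1: "\<theta> \<le> ang (Suc k)" unfolding k_def by (rule LeastI)
  have 2: "k \<le> K - 1" unfolding k_def by (rule Least_le) (rule K)
  have "ang k \<le> \<theta>"
  proof (cases k)
    case (Suc k')
    then have "\<not> \<theta> \<le> ang (Suc k')" using not_less_Least[of k' "\<lambda>k. \<theta> \<le> ang (Suc k)"] unfolding k_def by simp
    then show ?thesis using Suc by simp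
  qed (use assms in simp)
  moreover have "k < K" using 2 assms(3) by simp
  ultimately show ?thesis using that 1 by blast
qed

lemma ang_mult_n: "ang (k * n) = k * ang n"
proof (induction k)
  case (Suc k)
  have "ang (Suc k * n) = ang (k * n + n)" by (simp add: add.commute)
  also have "\<dots> = k * ang n + ang n" by (simp only: ang_add_n Suc.IH)
  finally show ?case by (simp add: algebra_simps)
qed simp

lemma ang_n_pos: "0 < ang n"
  using ang_less_Suc[of 0] ang_mono[of 1 n] n_pos by simp

lemma ex_sector_unbounded:
  assumes "0 \<le> \<theta>"
  obtains i where "ang i \<le> \<theta>" "\<theta> \<le> ang (Suc i)"
proof -
  obtain k :: nat where "\<theta> / ang n < k" using reals_Archimedean2 by blast
  then have "\<theta> < ang (k * n)" using ang_n_pos by (simp add: ang_mult_n field_simps)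
  moreover have "0 < k * n" using calculation assms by (cases "k * n") auto
  ultimately show ?thesis using ex_sector[of \<theta> "k * n"] assms that by (metis less_imp_le)
qed

text \<open>If the vertices wind around the centre \<open>m \<ge> 2\<close> times, the distance of the angle to the nearest
  tangency angle takes the same value at some \<open>\<theta>\<close> and \<open>\<theta> + 2 * pi\<close>, and there the closed curve crosses
  itself.\<close>

lemma winding_imp_crossing:
  assumes m: "ang n = 2 * pi * real m" "2 \<le> m"
  obtains i k where "i + 2 \<le> k" "k + 2 \<le> i + n"
    "closed_segment (V i) (V (Suc i)) \<inter> closed_segment (V k) (V (Suc k)) \<noteq> {}"
proof -
  \<comment> \<open>For \<open>\<theta> \<ge> 0\<close> the curve has radius
    \<open>q / cos (d \<theta>)\<close> at \<theta>, so equal values of \<open>d\<close> a full turn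
    apart mean equal points.\<close>
  define d where "d \<theta> = infdist \<theta> (range \<Theta>)" for \<theta>
  have d_eq: "d \<theta> = \<bar>\<theta> - \<Theta> i\<bar>" if "ang i \<le> \<theta>" "\<theta> \<le> ang (Suc i)" for i \<theta>
  proof (rule antisym)
    show "d \<theta> \<le> \<bar>\<theta> - \<Theta> i\<bar>"
      unfolding d_def by (metis infdist_le dist_real_def rangeI)
    show "\<bar>\<theta> - \<Theta> i\<bar> \<le> d \<theta>"
      unfolding d_def infdist_def
      by (auto intro!: cINF_greatest simp: dist_real_def \<Theta>_nearest[OF that])
  qed
  \<comment> \<open>The range starts at 1 so that the maximising index \<open>j\<close> satisfies
    \<open>\<Theta> 0 \<le> ang j\<close>, which makes room for the intermediate value
    theorem.\<close>
  define M where "M = Max (\<alpha> ` {1..n})"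
  have "M \<in> \<alpha> ` {1..n}" unfolding M_def using n_pos by (intro Max_in) auto
  then obtain j where j: "1 \<le> j" "\<alpha> j = M" by auto
  have M: "\<alpha> k \<le> M" for k
  proof -
    have per: "\<alpha> (a + b * n) = \<alpha> a" for a b
    proof (induction b)
      case (Suc b)
      then show ?case using \<alpha>_periodic[of "a + b * n"] by (simp add: ac_simps)
    qed simp
    have "\<alpha> k = \<alpha> (k mod n)" using per[of "k mod n" "k div n"] by simp
    also have "\<dots> = \<alpha> (if k mod n = 0 then n else k mod n)"
      using per[of 0 1] by simp
    also have "\<dots> \<le> M"
      unfolding M_def using n_pos by (intro Max_ge) (auto simp: less_imp_le)
    finally show ?thesis .
  qed
  have d_le: "d \<theta> \<le> M" if t: "0 \<le> \<theta>" for \<theta>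
  proof -
    obtain i where i: "ang i \<le> \<theta>" "\<theta> \<le> ang (Suc i)" by (rule ex_sector_unbounded[OF t])
    show ?thesis using d_eq[OF i] sector_angle(1,2)[OF i] M[of i] M[of "Suc i"] by linarith
  qed
  have "ang 1 \<le> ang j" using j(1) by (rule ang_mono)
  then have j0: "\<Theta> 0 \<le> ang j" using \<alpha>_pos[of 1] ang_Suc_\<Theta>[of 0] by simp
  have t0: "0 \<le> \<Theta> 0" using \<alpha>_pos[of 0] by (simp add: \<Theta>_def)
  \<comment> \<open>\<open>h\<close> is nonnegative at \<open>\<Theta> 0\<close>, where
    \<open>d\<close> vanishes, and nonpositive at \<open>ang j\<close>, where \<open>d\<close> is
    maximal.\<close>
  define h where "h \<theta> = d (\<theta> + 2 * pi) - d \<theta>" for \<theta>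
  have "d (\<Theta> 0) = 0" using d_eq[of 0 "\<Theta> 0"] \<alpha>_pos[of 0] \<alpha>_pos[of 1] by (simp add: \<Theta>_def ang_Suc)
  then have h0: "0 \<le> h (\<Theta> 0)" by (simp add: h_def d_def infdist_nonneg)
  have "d (ang j) = M"
    using d_eq[of j "ang j"] ang_less_Suc[of j] \<alpha>_pos[of j] j(2) by (simp add: \<Theta>_def)
  then have h1: "h (ang j) \<le> 0" using d_le[of "ang j + 2 * pi"] t0 j0 by (simp add: h_def)
  have "continuous_on {\<Theta> 0..ang j} h"
    unfolding h_def d_def by (intro continuous_intros)
  then obtain \<theta> where t: "\<Theta> 0 \<le> \<theta>" "\<theta> \<le> ang j" "h \<theta> = 0"
    using IVT2'[of h "ang j" 0 "\<Theta> 0"] h0 h1 j0 by auto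
  have t': "0 \<le> \<theta>" "0 \<le> \<theta> + 2 * pi" using t t0 by auto
  obtain i where i: "ang i \<le> \<theta>" "\<theta> \<le> ang (Suc i)" by (rule ex_sector_unbounded[OF t'(1)])
  obtain k where k: "ang k \<le> \<theta> + 2 * pi" "\<theta> + 2 * pi \<le> ang (Suc k)"
    by (rule ex_sector_unbounded[OF t'(2)])
  have eq: "\<bar>\<theta> - \<Theta> i\<bar> = \<bar>\<theta> + 2 * pi - \<Theta> k\<bar>"
    using t(3) d_eq[OF i] d_eq[OF k] by (simp add: h_def)
  \<comment> \<open>Two consecutive sectors span less than a full turn, so \<theta> and
    \<open>\<theta> + 2 * pi\<close> lie neither in the same sector nor in adjacent ones.\<close>
  have two: "ang (Suc (Suc l)) < ang l + 2 * pi" for l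
    using \<alpha>_less[of l] \<alpha>_less[of "Suc l"] \<alpha>_less[of "Suc (Suc l)"] by (simp add: ang_Suc)
  have "i + 2 \<le> k"
  proof (rule ccontr)
    assume "\<not> i + 2 \<le> k"
    then have "ang (Suc k) \<le> ang (Suc (Suc i))" by (intro ang_mono) simp
    then show False using two[of i] i k by linarith
  qed
  \<comment> \<open>The same gap on the other side of the cycle: as \<open>m \<ge> 2\<close>, the
    return of \<theta> after \<open>n\<close> sides is at least a full turn beyond
    \<open>\<theta> + 2 * pi\<close>. For winding number one the two would coincide.\<close>
  moreover have "k + 2 \<le> i + n"
  proof (rule ccontr)
    assume "\<not> k + 2 \<le> i + n"
    then have "ang (Suc (i + n)) \<le> ang (Suc (Suc k))" by (intro ang_mono) simp
    moreover have "ang (Suc (i + n)) = ang (Suc i) + 2 * pi * m"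
      using ang_add_n[of "Suc i"] m(1) by simp
    moreover have "2 * pi * m \<ge> 4 * pi" using m(2) by simp
    ultimately show False using two[of k] i k by linarith
  qed
  moreover have "(q / cos (\<theta> - \<Theta> i)) *\<^sub>R E \<theta> = (q / cos (\<theta> + 2 * pi - \<Theta> k)) *\<^sub>R E (\<theta> + 2 * pi)"
    using eq by (metis E_2pi cos_abs_real)
  then have "closed_segment (V i) (V (Suc i)) \<inter> closed_segment (V k) (V (Suc k)) \<noteq> {}"
    using sector_point_in_side[OF i] sector_point_in_side[OF k] by auto
  ultimately show ?thesis using that by blast
qed

section \<open>The polygon of winding number one: half-planes and sectors\<close>

definition halfplanes :: "(real^2) set" where
  "halfplanes = (\<Inter>k<n. {x. E (\<Theta> k) \<bullet> x \<le> q})"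

definition sector :: "nat \<Rightarrow> (real^2) set" where
  "sector k = {s *\<^sub>R E \<theta> | s \<theta>. 0 \<le> s \<and> ang k \<le> \<theta> \<and> \<theta> \<le> ang (Suc k) \<and> s * cos (\<theta> - \<Theta> k) \<le> q}"

text \<open>\<open>\<Theta> k\<close> is the closest tangency direction throughout sector
  \<open>k\<close>, hence side \<open>k\<close> gives the strongest of the half-plane constraints
  there.\<close>

lemma cos_sector_le:
  assumes a: "ang n = 2 * pi" and "k < n" "j < n" and t: "ang k \<le> \<theta>" "\<theta> \<le> ang (Suc k)"
  shows "cos (\<theta> - \<Theta> j) \<le> cos (\<theta> - \<Theta> k)"
proof -
  have 1: "\<bar>\<theta> - \<Theta> k\<bar> \<le> \<bar>\<theta> - \<Theta> j\<bar>" by (rule \<Theta>_nearest[OF t])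
  \<comment> \<open>Closeness is needed modulo \<open>2 * pi\<close>: \<open>\<Theta> j\<close> is
    compared also after adding a turn and, by shifting \<theta> instead, after subtracting
    one.\<close>
  have 2: "\<bar>\<theta> - \<Theta> k\<bar> \<le> \<bar>\<theta> - \<Theta> (j + n)\<bar>" by (rule \<Theta>_nearest[OF t])
  have "ang (k + n) \<le> \<theta> + 2 * pi" "\<theta> + 2 * pi \<le> ang (Suc (k + n))"
    using t ang_add_n[of k] ang_add_n[of "Suc k"] by (auto simp: a)
  then have 3: "\<bar>\<theta> + 2 * pi - \<Theta> (k + n)\<bar> \<le> \<bar>\<theta> + 2 * pi - \<Theta> j\<bar>" by (rule \<Theta>_nearest)
  have "0 \<le> ang k" "ang (Suc k) \<le> ang n" "0 \<le> ang j" "ang (Suc j) \<le> ang n"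
    using ang_mono[of 0 k] ang_mono[of "Suc k" n] ang_mono[of 0 j] ang_mono[of "Suc j" n] assms by auto
  moreover have "0 < \<Theta> j" "\<Theta> j < 2 * pi"
    using calculation(3,4) a \<alpha>_pos[of j] \<alpha>_pos[of "Suc j"] ang_Suc_\<Theta>[of j] by (auto simp: \<Theta>_def)
  ultimately have "\<bar>\<theta> - \<Theta> j\<bar> \<le> 2 * pi - \<bar>\<theta> - \<Theta> k\<bar>"
    using 1 2 3 t a unfolding \<Theta>_add_n a by linarith
  moreover have "\<bar>\<theta> - \<Theta> k\<bar> \<le> pi" using sector_angle(3)[OF t] pi_gt_zero by linarith
  ultimately have "cos (\<theta> - \<Theta> j) \<le> cos \<bar>\<theta> - \<Theta> k\<bar>"
    using 1 by (intro cos_le_cos_abs) auto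
  then show ?thesis by simp
qed

text \<open>Convexity and interior are read off the half-planes, the area off the sectors; in each
  sector only its own constraint is active.\<close>

lemma halfplanes_eq_sectors:
  assumes a: "ang n = 2 * pi"
  shows "halfplanes = (\<Union>k<n. sector k)"
proof safe
  fix x assume x: "x \<in> halfplanes"
  obtain s \<theta> where p: "0 \<le> s" "0 \<le> \<theta>" "\<theta> < 2 * pi" "x = s *\<^sub>R E \<theta>" by (rule polar)
  then obtain k where k: "k < n" "ang k \<le> \<theta>" "\<theta> \<le> ang (Suc k)"
    using ex_sector[of \<theta> n] a n_pos by auto
  then have "E (\<Theta> k) \<bullet> x \<le> q" using x by (auto simp: halfplanes_def)
  then have "s * cos (\<theta> - \<Theta> k) \<le> q"
    using p by (simp add: E_inner')
  then show "x \<in> (\<Union>k<n. sector k)" using k p by (auto simp: sector_def)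
next
  fix x k assume k: "k < n" and "x \<in> sector k"
  then obtain s \<theta> where x: "x = s *\<^sub>R E \<theta>" "0 \<le> s" "s * cos (\<theta> - \<Theta> k) \<le> q"
    and t: "ang k \<le> \<theta>" "\<theta> \<le> ang (Suc k)" by (auto simp: sector_def)
  have "E (\<Theta> j) \<bullet> x \<le> q" if "j < n" for j
  proof -
    have "s * cos (\<theta> - \<Theta> j) \<le> s * cos (\<theta> - \<Theta> k)"
      using x by (intro mult_left_mono cos_sector_le[OF a k that t])
    moreover have "E (\<Theta> j) \<bullet> x = s * cos (\<theta> - \<Theta> j)"
      by (simp add: x E_inner')
    ultimately show ?thesis using x(3) by linarith
  qed
  then show "x \<in> halfplanes" by (auto simp: halfplanes_def)
qed

lemma convex_halfplanes: "convex halfplanes"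
  unfolding halfplanes_def by (intro convex_INT) (simp add: convex_halfspace_le)

lemma interior_halfplanes: "interior halfplanes = (\<Inter>k<n. {x. E (\<Theta> k) \<bullet> x < q})"
proof
  show "interior halfplanes \<subseteq> (\<Inter>k<n. {x. E (\<Theta> k) \<bullet> x < q})"
  proof (rule INT_greatest)
    fix k assume "k \<in> {..<n}"
    then have "interior halfplanes \<subseteq> interior {x. E (\<Theta> k) \<bullet> x \<le> q}"
      unfolding halfplanes_def by (intro interior_mono) blast
    then show "interior halfplanes \<subseteq> {x. E (\<Theta> k) \<bullet> x < q}" by simp
  qed
  show "(\<Inter>k<n. {x. E (\<Theta> k) \<bullet> x < q}) \<subseteq> interior halfplanes"
    by (rule interior_maximal)
       (auto simp: halfplanes_def less_imp_le intro!: open_INT open_halfspace_lt)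
qed

lemma V_in_sector: "V k \<in> sector k" "V (Suc k) \<in> sector k"
proof -
  show "V k \<in> sector k"
    unfolding sector_def mem_Collect_eq V_def
    using cos_\<alpha>_pos[of k] q_pos ang_less_Suc[of k]
    by (intro exI[of _ "q / cos (\<alpha> k)"] exI[of _ "ang k"]) (auto simp: \<Theta>_def)
  show "V (Suc k) \<in> sector k"
    unfolding sector_def mem_Collect_eq V_def
    using cos_\<alpha>_pos[of "Suc k"] q_pos ang_less_Suc[of k]
    by (intro exI[of _ "q / cos (\<alpha> (Suc k))"] exI[of _ "ang (Suc k)"]) (auto simp: ang_Suc_\<Theta>)
qed

lemma E_\<Theta>_inner_V: "E (\<Theta> k) \<bullet> V k = q" "E (\<Theta> k) \<bullet> V (Suc k) = q"
proof -
  show "E (\<Theta> k) \<bullet> V k = q" using cos_\<alpha>_pos[of k] by (simp add: V_def E_inner \<Theta>_def)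
  have "E (\<Theta> k) \<bullet> V (Suc k) = (q / cos (\<alpha> (Suc k))) * cos (- \<alpha> (Suc k))"
    by (simp only: V_def inner_scaleR_right E_inner) (simp add: ang_Suc_\<Theta>)
  then show "E (\<Theta> k) \<bullet> V (Suc k) = q" using cos_\<alpha>_pos[of "Suc k"] by simp
qed

lemma closed_halfplanes: "closed halfplanes"
  unfolding halfplanes_def by (intro closed_INT) (simp add: closed_halfspace_le)

text \<open>A frontier point attains equality in some constraint \<open>j\<close>. In its sector
  \<open>k\<close> the constraint \<open>k\<close> is at least as strong, so equality holds there
  too, and the polar equation places the point on side \<open>k\<close>.\<close>

lemma frontier_halfplanes:
  assumes a: "ang n = 2 * pi"
  shows "frontier halfplanes = (\<Union>k<n. closed_segment (V k) (V (Suc k)))"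
proof -
  have fr: "frontier halfplanes = halfplanes - interior halfplanes"
    by (simp add: frontier_def closed_halfplanes)
  show ?thesis
  proof (intro equalityI subsetI)
    fix x assume "x \<in> frontier halfplanes"
    then have x: "x \<in> halfplanes" "x \<notin> interior halfplanes" by (auto simp: fr)
    then obtain j where j: "j < n" "q \<le> E (\<Theta> j) \<bullet> x"
      unfolding interior_halfplanes by (auto simp: not_less)
    obtain k where k: "k < n" "x \<in> sector k" using x(1) halfplanes_eq_sectors[OF a] by blast
    then obtain s \<theta> where xs: "x = s *\<^sub>R E \<theta>" "0 \<le> s" "s * cos (\<theta> - \<Theta> k) \<le> q"
      and t: "ang k \<le> \<theta>" "\<theta> \<le> ang (Suc k)" by (auto simp: sector_def)
    have "s * cos (\<theta> - \<Theta> j) \<le> s * cos (\<theta> - \<Theta> k)"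
      using xs by (intro mult_left_mono cos_sector_le[OF a k(1) j(1) t])
    moreover have "E (\<Theta> j) \<bullet> x = s * cos (\<theta> - \<Theta> j)"
      by (simp add: xs E_inner')
    ultimately have "s * cos (\<theta> - \<Theta> k) = q" using xs(3) j(2) by simp
    then have "s = q / cos (\<theta> - \<Theta> k)" using sector_angle(4)[OF t] by (simp add: field_simps)
    then have "x \<in> closed_segment (V k) (V (Suc k))"
      using sector_point_in_side[OF t] xs(1) by simp
    then show "x \<in> (\<Union>k<n. closed_segment (V k) (V (Suc k)))" using k by blast
  next
    fix x assume "x \<in> (\<Union>k<n. closed_segment (V k) (V (Suc k)))"
    then obtain k where k: "k < n" "x \<in> closed_segment (V k) (V (Suc k))" by blast
    have "V k \<in> halfplanes" "V (Suc k) \<in> halfplanes"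
      using V_in_sector[of k] k(1) halfplanes_eq_sectors[OF a] by blast+
    then have "x \<in> halfplanes"
      using k(2) closed_segment_subset[OF _ _ convex_halfplanes] by blast
    moreover obtain u where u: "x = (1 - u) *\<^sub>R V k + u *\<^sub>R V (Suc k)"
      using k(2) by (auto simp: closed_segment_def)
    have "E (\<Theta> k) \<bullet> x = (1 - u) * q + u * q"
      unfolding u by (simp add: inner_add_right E_\<Theta>_inner_V)
    then have "E (\<Theta> k) \<bullet> x = q" by (simp add: algebra_simps)
    then have "x \<notin> interior halfplanes" using k(1) unfolding interior_halfplanes by force
    ultimately show "x \<in> frontier halfplanes" by (simp add: fr)
  qed
qed

text \<open>In the frame of the tangency direction the angle bounds become slope bounds through
  \<open>tan\<close>, which brings in the area computed in Cartesian coordinates.\<close>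

lemma sector_eq_image:
  "sector k = (\<lambda>z. z $ 1 *\<^sub>R E (\<Theta> k) + z $ 2 *\<^sub>R E (\<Theta> k + pi / 2)) `
     cone_triangle q (tan (\<alpha> k)) (tan (\<alpha> (Suc k)))" (is "_ = ?L ` ?T")
proof (intro equalityI subsetI)
  fix x assume "x \<in> sector k"
  then obtain s \<theta> where x: "x = s *\<^sub>R E \<theta>" "0 \<le> s" "s * cos (\<theta> - \<Theta> k) \<le> q"
    and t: "ang k \<le> \<theta>" "\<theta> \<le> ang (Suc k)" by (auto simp: sector_def)
  note sa = sector_angle[OF t]
  define \<delta> where "\<delta> = \<theta> - \<Theta> k"
  have c: "0 < cos \<delta>" using sa by (simp add: \<delta>_def)
  have "x = s *\<^sub>R E (\<Theta> k + \<delta>)" by (simp add: x \<delta>_def)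
  then have "x = ?L (vector [s * cos \<delta>, s * sin \<delta>])"
    unfolding E_add[of "\<Theta> k" \<delta>] by (simp add: scaleR_add_right)
  moreover have "vector [s * cos \<delta>, s * sin \<delta>] \<in> ?T"
  proof -
    have e: "s * sin \<delta> = tan \<delta> * (s * cos \<delta>)" using c by (simp add: tan_def)
    have "tan (- \<alpha> k) \<le> tan \<delta>"
      using sa(1,3) \<alpha>_less[of k] unfolding \<delta>_def by (intro tan_mono_le) linarith+
    moreover have "tan \<delta> \<le> tan (\<alpha> (Suc k))"
      using sa(2,3) \<alpha>_less[of "Suc k"] unfolding \<delta>_def by (intro tan_mono_le) linarith+
    moreover have "0 \<le> s * cos \<delta>" using c x by simp
    ultimately have "- tan (\<alpha> k) * (s * cos \<delta>) \<le> s * sin \<delta>" "s * sin \<delta> \<le> tan (\<alpha> (Suc k)) * (s * cos \<delta>)"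
      unfolding e by (simp_all only: tan_minus mult_right_mono)
    then show ?thesis using \<open>0 \<le> s * cos \<delta>\<close> x(3) by (simp add: cone_triangle_def \<delta>_def)
  qed
  ultimately show "x \<in> ?L ` ?T" by blast
next
  fix x assume "x \<in> ?L ` ?T"
  then obtain z where z: "x = ?L z" "z \<in> ?T" by blast
  then have zt: "0 \<le> z $ 1" "z $ 1 \<le> q" "- tan (\<alpha> k) * z $ 1 \<le> z $ 2" "z $ 2 \<le> tan (\<alpha> (Suc k)) * z $ 1"
    by (auto simp: cone_triangle_def)
  show "x \<in> sector k"
  \<comment> \<open>The apex has no slope; it is represented with radius 0 and angle
    \<open>ang k\<close>.\<close>
  proof (cases "z $ 1 = 0")
    case True
    then have "x = 0 *\<^sub>R E (ang k)" using z zt by simp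
    then show ?thesis
      unfolding sector_def using q_pos ang_less_Suc[of k]
      by (auto intro!: exI[of _ 0] exI[of _ "ang k"])
  next
    case False
    then have z1: "0 < z $ 1" using zt by simp
    define \<delta> where "\<delta> = arctan (z $ 2 / z $ 1)"
    have d: "tan \<delta> = z $ 2 / z $ 1" "- (pi / 2) < \<delta>" "\<delta> < pi / 2"
      unfolding \<delta>_def using arctan[of "z $ 2 / z $ 1"] by blast+
    then have c: "0 < cos \<delta>" by (intro cos_gt_zero_pi) auto
    define s where "s = z $ 1 / cos \<delta>"
    have s: "s * cos \<delta> = z $ 1" using c by (simp add: s_def)
    have "sin \<delta> = tan \<delta> * cos \<delta>" using c by (simp add: tan_def)
    then have "s * sin \<delta> = z $ 2" using c z1 by (simp add: s_def d)
    then have "x = s *\<^sub>R E (\<Theta> k + \<delta>)"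
      unfolding E_add[of "\<Theta> k" \<delta>] using s z(1) by (simp add: scaleR_add_right)
    moreover have "\<delta> \<le> \<alpha> (Suc k)"
    proof -
      have "z $ 2 / z $ 1 \<le> tan (\<alpha> (Suc k))" using z1 zt by (simp add: field_simps)
      then have "\<delta> \<le> arctan (tan (\<alpha> (Suc k)))" unfolding \<delta>_def by (rule arctan_monotone')
      then show ?thesis using \<alpha>_pos[of "Suc k"] \<alpha>_less[of "Suc k"] by (simp add: arctan_tan)
    qed
    moreover have "- \<alpha> k \<le> \<delta>"
    proof -
      have "- tan (\<alpha> k) \<le> z $ 2 / z $ 1" using z1 zt by (simp add: field_simps)
      then have "arctan (tan (- \<alpha> k)) \<le> \<delta>" unfolding \<delta>_def by (intro arctan_monotone') simp
      then show ?thesis using \<alpha>_pos[of k] \<alpha>_less[of k] arctan_tan[of "- \<alpha> k"] by simp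
    qed
    moreover have "0 \<le> s" using c z1 by (simp add: s_def)
    ultimately have "x = s *\<^sub>R E (\<Theta> k + \<delta>) \<and> 0 \<le> s \<and> ang k \<le> \<Theta> k + \<delta> \<and> \<Theta> k + \<delta> \<le> ang (Suc k)
        \<and> s * cos (\<Theta> k + \<delta> - \<Theta> k) \<le> q"
      using s zt(2) by (simp add: ang_Suc_\<Theta>) (simp add: \<Theta>_def)
    then show ?thesis unfolding sector_def by blast
  qed
qed

text \<open>A nonzero common point has angles in both sectors that differ by a multiple of
  \<open>2 * pi\<close>. All angles lie in one turn, so these are either both a common bounding
  angle or 0 and \<open>2 * pi\<close>; the overlap lies on finitely many lines.\<close>

lemma sector_overlap_negligible:
  assumes a: "ang n = 2 * pi" and "i < n" "k < n" "i \<noteq> k"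
  shows "negligible (sector i \<inter> sector k)"
proof -
  have "negligible (sector i \<inter> sector k)" if ik: "i < k" "k < n" for i k
  proof (rule negligible_subset)
    show "negligible (\<Union>j\<le>n. span {E (ang j)})"
      by (intro negligible_Union) (auto intro!: negligible_lowdim simp: dim_singleton)
    show "sector i \<inter> sector k \<subseteq> (\<Union>j\<le>n. span {E (ang j)})"
    proof
      fix x assume x: "x \<in> sector i \<inter> sector k"
      then obtain s \<theta> where s: "x = s *\<^sub>R E \<theta>" "0 \<le> s" "ang i \<le> \<theta>" "\<theta> \<le> ang (Suc i)"
        by (auto simp: sector_def)
      obtain u \<eta> where u: "x = u *\<^sub>R E \<eta>" "0 \<le> u" "ang k \<le> \<eta>" "\<eta> \<le> ang (Suc k)"
        using x by (auto simp: sector_def)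
      show "x \<in> (\<Union>j\<le>n. span {E (ang j)})"
      proof (cases "x = 0")
        case False
        have "norm x = s" "norm x = u" using s u by (simp, metis abs_of_nonneg mult.right_neutral norm_E norm_scaleR)
        then have "E \<theta> = E \<eta>" using s u False by auto
        then obtain m :: int where m: "\<theta> - \<eta> = m * 2 * pi" by (auto simp: E_eq_iff)
        have b: "0 \<le> \<theta>" "\<theta> \<le> ang k" "ang k \<le> \<eta>" "\<eta> \<le> 2 * pi"
          using s u ang_mono[of 0 i] ang_mono[of "Suc i" k] ang_mono[of "Suc k" n] ik a by auto
        show ?thesis
        proof (cases "m = 0")
          case True
          then have "\<theta> = ang k" using m b by simp
          then have "x \<in> span {E (ang k)}" using s by (simp add: span_mul span_base)
          then show ?thesis using ik by force
        next
          case False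
          then have "1 \<le> \<bar>real_of_int m\<bar>" by linarith
          then have "2 * pi \<le> \<bar>real_of_int m\<bar> * 2 * pi" by simp
          also have "\<dots> = \<bar>\<theta> - \<eta>\<bar>" by (simp add: m abs_mult)
          finally have "\<theta> = 0" using b by linarith
          then have "x \<in> span {E (ang 0)}" using s by (simp add: span_mul span_base)
          then show ?thesis by force
        qed
      qed (auto intro: span_zero)
    qed
  qed
  then show ?thesis using assms by (metis Int_commute linorder_neqE_nat)
qed

text \<open>The assumption says that vertex \<open>k\<close>, at distance
  \<open>q / cos (\<alpha> k)\<close> from the centre, lies in the disc.\<close>

lemma tan_bound:
  assumes "q < cos (\<alpha> k)"
  shows "(1 + (tan (\<alpha> k))\<^sup>2) * q\<^sup>2 < 1"
proof -
  have c: "0 < cos (\<alpha> k)" by (rule cos_\<alpha>_pos)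
  have "1 + (tan (\<alpha> k))\<^sup>2 = 1 / (cos (\<alpha> k))\<^sup>2"
    using c by (simp add: tan_sec inverse_eq_divide power_divide)
  moreover have "q\<^sup>2 < (cos (\<alpha> k))\<^sup>2" using assms q_pos by (intro power_strict_mono) auto
  ultimately show ?thesis using c by simp
qed

lemma tan_\<alpha>_pos: "0 < tan (\<alpha> k)"
  using \<alpha>_pos \<alpha>_less by (simp add: tan_gt_zero)

lemma sector_compact:
  assumes "\<And>k. q < cos (\<alpha> k)"
  shows "compact (sector k)" "sector k \<subseteq> hplane"
proof -
  note T = q_pos tan_\<alpha>_pos[of k] tan_\<alpha>_pos[of "Suc k"] tan_bound[OF assms, of k] tan_bound[OF assms, of "Suc k"]
  show "compact (sector k)"
    unfolding sector_eq_image
    by (intro compact_continuous_image compact_cone_triangle[OF T] continuous_intros)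
  show "sector k \<subseteq> hplane"
  proof -
    have "(\<lambda>z. z $ 1 *\<^sub>R E (\<Theta> k) + z $ 2 *\<^sub>R E (\<Theta> k + pi / 2)) z \<in> hplane" if "z \<in> hplane" for z :: "real^2"
      using that E_orthonormal[of "\<Theta> k"]
      by (simp add: hplane_iff_inner inner_add_left inner_add_right inner_commute[of "E (\<Theta> k + pi / 2)" "E (\<Theta> k)"] inner_vec_2[of z])
    then show ?thesis
      unfolding sector_eq_image using cone_triangle_subset_hplane[OF T] by blast
  qed
qed

lemma halfplanes_compact:
  assumes "ang n = 2 * pi" "\<And>k. q < cos (\<alpha> k)"
  shows "compact halfplanes" "halfplanes \<subseteq> hplane"
  unfolding halfplanes_eq_sectors[OF assms(1)] using sector_compact[OF assms(2)] by auto

lemma harea_halfplanes: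
  assumes a: "ang n = 2 * pi" and q: "\<And>k. q < cos (\<alpha> k)"
  shows "harea halfplanes = (\<Sum>k<n. 2 * (pi / 2 - \<alpha> k - arccos (sin (\<alpha> k) / sqrt (1 - q\<^sup>2))))"
proof -
  define G where "G k = pi / 2 - \<alpha> k - arccos (sin (\<alpha> k) / sqrt (1 - q\<^sup>2))" for k
  have G: "arctan (1 / tan (\<alpha> k)) - arctan (sqrt (1 - (1 + (tan (\<alpha> k))\<^sup>2) * q\<^sup>2) / tan (\<alpha> k)) = G k" for k
    unfolding G_def by (rule slice_area_closed_form[OF \<alpha>_pos \<alpha>_less q_pos q])
  have sec: "harea (sector k) = G k + G (Suc k)" for k
  proof -
    note T = q_pos tan_\<alpha>_pos[of k] tan_\<alpha>_pos[of "Suc k"] tan_bound[OF q, of k] tan_bound[OF q, of "Suc k"]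
    show ?thesis
      unfolding sector_eq_image G[symmetric]
      by (simp only: harea_orthonormal_image[OF E_orthonormal compact_cone_triangle[OF T] cone_triangle_subset_hplane[OF T]]
          harea_cone_triangle[OF T])
  qed
  have "(hdensity has_integral (\<Sum>k<n. harea (sector k))) (\<Union>k<n. sector k)"
  proof (rule has_integral_UN)
    show "(hdensity has_integral harea (sector k)) (sector k)" for k
      using harea_eq_integral[OF sector_compact[OF q], of k]
      by (simp add: integrable_integral set_lebesgue_integral_eq_integral(1))
    show "pairwise (\<lambda>i k. negligible (sector i \<inter> sector k)) {..<n}"
      using sector_overlap_negligible[OF a] by (auto simp: pairwise_def)
  qed simp
  then have "harea halfplanes = (\<Sum>k<n. harea (sector k))"
    using harea_eq_integral(1)[OF halfplanes_compact[OF a q]]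
    by (simp add: halfplanes_eq_sectors[OF a] integral_unique)
  also have "\<dots> = (\<Sum>k<n. G k) + (\<Sum>k<n. G (Suc k))"
    by (simp add: sec sum.distrib)
  \<comment> \<open>Periodicity allows the shift: the right triangles on both sides of a vertex have
    equal area, which is the origin of the factor 2.\<close>
  also have "(\<Sum>k<n. G (Suc k)) = (\<Sum>k<n. G k)"
  proof -
    have "(\<Sum>k<n. G (Suc k)) + G 0 = (\<Sum>k<Suc n. G k)"
      by (simp only: sum.lessThan_Suc_shift add.commute)
    also have "\<dots> = (\<Sum>k<n. G k) + G 0" using \<alpha>_periodic[of 0] by (simp add: G_def)
    finally show ?thesis by simp
  qed
  also have "(\<Sum>k<n. G k) + (\<Sum>k<n. G k) = (\<Sum>k<n. 2 * G k)"
    by (simp flip: sum_distrib_left)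
  finally show ?thesis by (simp only: G_def)
qed

lemma sum_\<alpha>: "2 * (\<Sum>k<n. \<alpha> k) = ang n"
proof -
  have "(\<Sum>k<n. \<alpha> (Suc k)) + \<alpha> 0 = (\<Sum>k<Suc n. \<alpha> k)"
    by (simp only: sum.lessThan_Suc_shift add.commute)
  then show ?thesis using \<alpha>_periodic[of 0] by (simp add: ang_def sum.distrib)
qed

end

section \<open>Tangential polygons\<close>

lemma hdist_zero_eq_iff:
  assumes "x \<in> hplane" "0 \<le> r"
  shows "hdist 0 x = r \<longleftrightarrow> norm x = tanh r"
proof -
  have n: "0 \<le> norm x" "norm x < 1" using assms by (auto simp: hplane_def)
  have x1: "0 < 1 - (norm x)\<^sup>2" using n by (simp add: power_less_one_iff abs_square_less_1)
  define w where "w = 1 / sqrt (1 - (norm x)\<^sup>2)"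
  have "sqrt (1 - (norm x)\<^sup>2) \<le> 1" by simp
  then have w1: "1 \<le> w" using x1 by (simp add: w_def)
  have "hdist 0 x = arcosh w" by (simp add: hdist_def w_def)
  then have "hdist 0 x = r \<longleftrightarrow> w = cosh r"
    using w1 assms(2) by (metis arcosh_cosh_real cosh_arcosh_real)
  also have "\<dots> \<longleftrightarrow> w\<^sup>2 = (cosh r)\<^sup>2"
    using w1 cosh_real_ge_1[of r] by (simp add: power2_eq_iff_nonneg)
  also have "\<dots> \<longleftrightarrow> 1 = (cosh r)\<^sup>2 * (1 - (norm x)\<^sup>2)"
    using x1 by (simp add: w_def power_divide field_simps)
  also have "\<dots> \<longleftrightarrow> (norm x)\<^sup>2 = (tanh r)\<^sup>2"
  proof -
    define C where "C = (cosh r)\<^sup>2"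
    have C: "0 < C" by (simp add: C_def)
    have t: "(tanh r)\<^sup>2 = (C - 1) / C"
      using cosh_square_eq[of r] by (simp add: tanh_def power_divide C_def)
    show ?thesis
      unfolding C_def[symmetric] t using C by (auto simp: field_simps)
  qed
  also have "\<dots> \<longleftrightarrow> norm x = tanh r"
    using n assms(2) by (simp add: power2_eq_iff_nonneg)
  finally show ?thesis .
qed

text \<open>Reflecting \<open>t\<close> in the foot of the perpendicular from 0 to the line gives a
  point \<open>y\<close> of the line with the same norm. Uniqueness forces \<open>y = t\<close>, so
  \<open>t\<close> is itself the foot.\<close>

lemma tangent_point_orthogonal:
  fixes a b :: "real^2"
  assumes "a \<noteq> b" and t: "t \<in> closed_segment a b" "norm t = q" "q < 1"
    and unique: "\<And>y. y \<in> hline a b \<Longrightarrow> norm y = q \<Longrightarrow> y = t"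
  shows "t \<bullet> a = q\<^sup>2" "t \<bullet> b = q\<^sup>2"
proof -
  define d where "d = b - a"
  have d: "d \<bullet> d \<noteq> 0" using assms(1) by (simp add: d_def)
  obtain u where u: "t = (1 - u) *\<^sub>R a + u *\<^sub>R b" using t(1) by (auto simp: closed_segment_def)
  define m where "m = 2 * (t \<bullet> d) / (d \<bullet> d)"
  define y where "y = t - m *\<^sub>R d"
  have y: "y = (1 - (u - m)) *\<^sub>R a + (u - m) *\<^sub>R b"
    by (simp add: y_def u d_def algebra_simps)
  have "y \<bullet> y = t \<bullet> t - 2 * m * (t \<bullet> d) + m * (m * (d \<bullet> d))"
    by (simp add: y_def inner_diff_left inner_diff_right inner_commute[of d t] algebra_simps)
  also have "m * (d \<bullet> d) = 2 * (t \<bullet> d)" using d by (simp add: m_def)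
  finally have "y \<bullet> y = t \<bullet> t" by simp
  then have ny: "norm y = q" using t(2) by (simp add: norm_eq_sqrt_inner)
  then have "y \<in> hplane" using t(3) by (simp add: hplane_def)
  then have "y \<in> hline a b" unfolding hline_iff using y by blast
  then have "y = t" using unique ny by blast
  then have "m *\<^sub>R d = 0" by (simp add: y_def)
  then have td: "t \<bullet> d = 0" using d by (auto simp: m_def)
  have tt: "t \<bullet> t = q\<^sup>2" using t(2) by (simp flip: power2_norm_eq_inner)
  have ab: "a = t - u *\<^sub>R d" "b = t + (1 - u) *\<^sub>R d" by (simp_all add: u d_def algebra_simps)
  show "t \<bullet> a = q\<^sup>2" by (subst ab) (simp add: inner_diff_right td tt)
  show "t \<bullet> b = q\<^sup>2" by (subst ab) (simp add: inner_add_right td tt)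
qed

lemma eq_if_inner_eq_norms:
  fixes x y :: "'a::real_inner"
  assumes "norm x = q" "norm y = q" "x \<bullet> y = q\<^sup>2" shows "x = y"
proof -
  have "x \<bullet> x = q\<^sup>2" "y \<bullet> y = q\<^sup>2" using assms by (simp_all flip: power2_norm_eq_inner)
  then have "(x - y) \<bullet> (x - y) = 0"
    using assms(3) by (simp add: inner_diff_left inner_diff_right inner_commute[of y x] del: inner_eq_zero_iff)
  then show ?thesis by simp
qed

text \<open>By induction along the chain: the next vertex is on a known line at a known distance,
  the next tangency point on one of two tangents from that vertex. Each choice of two is decided,
  the first by \<open>seg\<close>, the second by \<open>tt\<close>.\<close>

lemma tangent_chain_fan:
  fixes W t :: "nat \<Rightarrow> real^2"
  assumes q: "0 < q" and n: "0 < n" and per: "\<And>k. W (k + n) = W k"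
    and seg: "\<And>k. t k \<in> closed_segment (W k) (W (Suc k))" and nt: "\<And>k. norm (t k) = q"
    and tW: "\<And>k. t k \<bullet> W k = q\<^sup>2" and tW': "\<And>k. t k \<bullet> W (Suc k) = q\<^sup>2"
    and tt: "\<And>k. t k \<noteq> t (Suc k)" and W1: "\<And>k. norm (W k) < 1"
  obtains f1 f2 \<alpha> where "tangential_fan f1 f2 q n \<alpha>" "\<And>k. q < cos (\<alpha> k)"
    "\<And>k. W k = tangential_fan.V f1 f2 q \<alpha> k"
proof -
  have Wq': "q < norm (W (Suc k))" for k
  proof -
    have "q\<^sup>2 \<le> q * norm (W (Suc k))"
      using norm_cauchy_schwarz[of "t k" "W (Suc k)"] nt[of k] tW'[of k] by simp
    then have "q \<le> norm (W (Suc k))" using q by (simp add: power2_eq_square)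
    \<comment> \<open>A vertex on the circle would coincide with the tangency points of both its
      sides, which are distinct.\<close>
    moreover have "norm (W (Suc k)) \<noteq> q"
      using eq_if_inner_eq_norms[OF nt _ tW'[of k]] eq_if_inner_eq_norms[OF nt _ tW[of "Suc k"]] tt[of k]
      by metis
    ultimately show ?thesis by simp
  qed
  \<comment> \<open>Vertex 0 is reached as the successor of vertex \<open>n - 1\<close>.\<close>
  have Wq: "q < norm (W k)" for k
    using Wq'[of "k + n - 1"] per[of k] n by simp
  define \<alpha> where "\<alpha> k = arccos (q / norm (W k))" for k
  have b: "0 < q / norm (W k)" "q / norm (W k) < 1" for k
    using q Wq[of k] by (auto simp: divide_simps)
  have cos: "cos (\<alpha> k) = q / norm (W k)" for k
    unfolding \<alpha>_def using b[of k] by (intro cos_arccos) auto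
  have \<alpha>: "0 < \<alpha> k" "\<alpha> k < pi / 2" for k
    using b[of k] arccos_lt_bounded[of "q / norm (W k)"] arccos_less_arccos[of 0 "q / norm (W k)"]
    by (simp_all add: \<alpha>_def)
  have sin: "0 < sin (\<alpha> k)" for k using \<alpha>[of k] by (intro sin_gt_zero) auto
  have coscos: "cos (\<alpha> k) * cos (\<alpha> k) = 1 - sin (\<alpha> k) * sin (\<alpha> k)" for k
    using sin_cos_squared_add[of "\<alpha> k"] by (simp add: power2_eq_square)
  have normW: "norm (W k) = q / cos (\<alpha> k)" for k using cos[of k] b(1)[of k] q by simp
  \<comment> \<open>The frame is dictated by the start: \<open>W 0\<close> gets the angle 0 and
    \<open>t 0\<close> the angle \<open>\<alpha> 0\<close>, which also fixes the
    orientation.\<close>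
  define f1 where "f1 = (1 / norm (W 0)) *\<^sub>R W 0"
  define f2 where "f2 = (1 / sin (\<alpha> 0)) *\<^sub>R ((1 / q) *\<^sub>R t 0 - cos (\<alpha> 0) *\<^sub>R f1)"
  have W0: "norm (W 0) > 0" using Wq[of 0] q by linarith
  have f11: "f1 \<bullet> f1 = 1" using W0 by (simp add: f1_def dot_square_norm power2_eq_square)
  have f1t: "f1 \<bullet> ((1 / q) *\<^sub>R t 0) = cos (\<alpha> 0)"
    using q by (simp add: f1_def inner_commute[of "W 0"] tW cos power2_eq_square)
  have t00: "((1 / q) *\<^sub>R t 0) \<bullet> ((1 / q) *\<^sub>R t 0) = 1"
    using q nt[of 0] by (simp add: dot_square_norm power2_eq_square)
  have f12: "f1 \<bullet> f2 = 0"
    unfolding f2_def by (simp only: inner_scaleR_right inner_diff_right f1t[unfolded inner_scaleR_right] f11) simp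
  have f22: "f2 \<bullet> f2 = 1"
  proof -
    define x where "x = (1 / q) *\<^sub>R t 0"
    have x: "x \<bullet> x = 1" "f1 \<bullet> x = cos (\<alpha> 0)" "x \<bullet> f1 = cos (\<alpha> 0)"
      using f1t t00 by (auto simp: x_def inner_commute[of _ f1])
    have "(x - cos (\<alpha> 0) *\<^sub>R f1) \<bullet> (x - cos (\<alpha> 0) *\<^sub>R f1) = sin (\<alpha> 0) * sin (\<alpha> 0)"
      by (simp add: inner_diff_left inner_diff_right x f11 coscos)
    then show ?thesis using sin[of 0] by (simp add: f2_def x_def)
  qed
  interpret F: tangential_fan f1 f2 q n \<alpha>
    by unfold_locales (use f11 f22 f12 q n \<alpha> per in \<open>auto simp: \<alpha>_def\<close>)
  have chain: "W k = F.V k \<and> t k = q *\<^sub>R F.E (F.\<Theta> k)" for k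
  proof (induction k)
    case 0
    have "F.V 0 = norm (W 0) *\<^sub>R f1" by (simp add: F.V_def F.E_def normW)
    then have "W 0 = F.V 0" using W0 by (simp add: f1_def)
    moreover have "t 0 = q *\<^sub>R F.E (F.\<Theta> 0)"
    proof -
      have "sin (\<alpha> 0) *\<^sub>R f2 = (1 / q) *\<^sub>R t 0 - cos (\<alpha> 0) *\<^sub>R f1"
        using sin[of 0] by (simp add: f2_def)
      then have "F.E (\<alpha> 0) = (1 / q) *\<^sub>R t 0" by (simp add: F.E_def)
      then show ?thesis using q by (simp add: F.\<Theta>_def)
    qed
    ultimately show ?case by simp
  next
    case (Suc k)
    define e f where "e = F.E (F.\<Theta> k)" and "f = F.E (F.\<Theta> k + pi / 2)"
    have ef: "e \<bullet> e = 1" "f \<bullet> f = 1" "e \<bullet> f = 0" "f \<bullet> e = 0"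
      using F.E_orthonormal[of "F.\<Theta> k"] by (auto simp: e_def f_def inner_commute)
    have tk: "t k = q *\<^sub>R e" using Suc by (simp add: e_def)
    define y where "y = W (Suc k) \<bullet> f"
    have We: "W (Suc k) \<bullet> e = q"
      using tW'[of k] q by (simp add: tk inner_commute[of e] power2_eq_square)
    have W: "W (Suc k) = q *\<^sub>R e + y *\<^sub>R f"
      using inner_orthonormal_expansion[OF ef(1-3), of "W (Suc k)"] by (simp add: We y_def)
    have "(norm (W (Suc k)))\<^sup>2 = q\<^sup>2 + y\<^sup>2"
      unfolding power2_norm_eq_inner W by (simp add: inner_add_left inner_add_right ef power2_eq_square)
    also have "(norm (W (Suc k)))\<^sup>2 = q\<^sup>2 * (1 + (tan (\<alpha> (Suc k)))\<^sup>2)"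
      unfolding normW using F.cos_\<alpha>_pos[of "Suc k"] by (simp add: power_divide tan_sec inverse_eq_divide)
    finally have y2: "y\<^sup>2 = (q * tan (\<alpha> (Suc k)))\<^sup>2" by (simp add: algebra_simps power_mult_distrib)
    have qt: "0 < q * tan (\<alpha> (Suc k))" "0 < q * tan (\<alpha> k)"
      using q F.tan_\<alpha>_pos by auto
    obtain u where u: "0 \<le> u" "u \<le> 1" "t k = (1 - u) *\<^sub>R W k + u *\<^sub>R W (Suc k)"
      using seg[of k] by (auto simp: closed_segment_def)
    have Wk: "W k = q *\<^sub>R e + (- tan (\<alpha> k)) *\<^sub>R (q *\<^sub>R f)"
      using Suc F.V_left[of k] by (simp add: e_def f_def)
    have "t k \<bullet> f = (1 - u) * (W k \<bullet> f) + u * y"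
      by (simp only: u(3) inner_add_left inner_scaleR_left y_def)
    moreover have "t k \<bullet> f = 0" by (simp add: tk ef)
    moreover have "W k \<bullet> f = - (q * tan (\<alpha> k))" by (simp add: Wk inner_diff_left inner_add_left ef)
    ultimately have uy: "u * y = (1 - u) * (q * tan (\<alpha> k))" by simp
    \<comment> \<open>The norm of \<open>W (Suc k)\<close> leaves two positions on the tangent line.
      As \<open>t k\<close> is on the side and \<open>W k\<close> has a negative coordinate, that of
      \<open>W (Suc k)\<close> is positive.\<close>
    have "y > 0"
    proof (rule ccontr)
      assume "\<not> y > 0"
      then have "u * y \<le> 0" using u by (simp add: mult_nonneg_nonpos)
      moreover have "0 \<le> (1 - u) * (q * tan (\<alpha> k))" using u qt by simp
      ultimately have "u * y = 0" "(1 - u) * (q * tan (\<alpha> k)) = 0" using uy by auto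
      then have "u = 1" "y = 0" using qt by auto
      then have "y\<^sup>2 = 0" by simp
      moreover have "0 < (q * tan (\<alpha> (Suc k)))\<^sup>2" using qt(1) by (rule zero_less_power)
      ultimately show False using y2 by linarith
    qed
    then have "y = q * tan (\<alpha> (Suc k))"
      using y2 qt by (simp add: power2_eq_iff_nonneg)
    then have WV: "W (Suc k) = F.V (Suc k)"
      unfolding W F.V_right by (simp add: e_def f_def mult.commute)
    define e' f' where "e' = F.E (F.ang (Suc k))" and "f' = F.E (F.ang (Suc k) + pi / 2)"
    have ef': "e' \<bullet> e' = 1" "f' \<bullet> f' = 1" "e' \<bullet> f' = 0" "f' \<bullet> e' = 0"
      using F.E_orthonormal[of "F.ang (Suc k)"] by (auto simp: e'_def f'_def inner_commute)
    have te: "t (Suc k) \<bullet> e' = q * cos (\<alpha> (Suc k))"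
      using tW[of "Suc k"] q F.cos_\<alpha>_pos[of "Suc k"]
      unfolding WV F.V_def by (simp add: e'_def power2_eq_square field_simps)
    define z where "z = t (Suc k) \<bullet> f'"
    have tz: "t (Suc k) = (q * cos (\<alpha> (Suc k))) *\<^sub>R e' + z *\<^sub>R f'"
      using inner_orthonormal_expansion[OF ef'(1-3), of "t (Suc k)"] by (simp add: te z_def)
    have "q\<^sup>2 = (norm (t (Suc k)))\<^sup>2" by (simp add: nt)
    also have "\<dots> = (q * cos (\<alpha> (Suc k)))\<^sup>2 + z\<^sup>2"
      unfolding power2_norm_eq_inner tz by (simp add: inner_add_left inner_add_right ef' power2_eq_square)
    finally have "z\<^sup>2 = (q * sin (\<alpha> (Suc k)))\<^sup>2"
      by (simp add: power_mult_distrib sin_squared_eq algebra_simps)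
    \<comment> \<open>The two tangents from \<open>W (Suc k)\<close> touch the circle at the angles
      \<open>\<Theta> (Suc k)\<close> and \<open>\<Theta> k\<close>; the second point is
      \<open>t k\<close>, excluded by \<open>tt\<close>.\<close>
    then consider "z = q * sin (\<alpha> (Suc k))" | "z = - (q * sin (\<alpha> (Suc k)))"
      by (auto simp: power2_eq_iff)
    then have "t (Suc k) = q *\<^sub>R F.E (F.\<Theta> (Suc k))"
    proof cases
      case 1
      then show ?thesis
        unfolding tz F.\<Theta>_def F.E_add[of "F.ang (Suc k)" "\<alpha> (Suc k)"] by (simp add: e'_def f'_def scaleR_add_right)
    next
      case 2
      have "F.E (F.\<Theta> k) = F.E (F.ang (Suc k) + - \<alpha> (Suc k))" by (simp add: F.ang_Suc_\<Theta>)
      then have "t (Suc k) = q *\<^sub>R F.E (F.\<Theta> k)"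
        unfolding tz 2 F.E_add[of "F.ang (Suc k)" "- \<alpha> (Suc k)"] by (simp add: e'_def f'_def scaleR_diff_right)
      then show ?thesis using Suc tt[of k] by simp
    qed
    with WV show ?case by simp
  qed
  have "q < cos (\<alpha> k)" for k
  proof -
    have "q * norm (W k) < q * 1" using W1[of k] q by (intro mult_strict_left_mono)
    moreover have "0 < norm (W k)" using Wq[of k] q by linarith
    ultimately show ?thesis by (simp add: cos less_divide_eq)
  qed
  then show ?thesis using that F.tangential_fan_axioms chain by blast
qed

section \<open>The polygon seen from its incentre\<close>

lemma vertex_mod: "vertex P (i mod length P) = vertex P i"
  by (simp add: vertex_def)

lemma vertex_Suc_mod: "vertex P (Suc (i mod length P)) = vertex P (Suc i)"
  by (simp add: vertex_def mod_Suc_eq)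

lemma side_mod: "side P (i mod length P) = side P i"
  by (simp add: side_def vertex_mod vertex_Suc_mod)

lemma vertex_in_hplane: "hpolygon n P \<Longrightarrow> 0 < n \<Longrightarrow> vertex P i \<in> hplane"
  by (auto simp: hpolygon_def vertex_def intro: subsetD[OF _ nth_mem])

lemma hpolygon_not_collinear:
  assumes "hpolygon n P" "0 < n"
  shows "\<not> collinear {vertex P i, vertex P (Suc i), vertex P (Suc (Suc i))}"
proof -
  have "length P = n" using assms by (simp add: hpolygon_def)
  then have "vertex P (i mod n) = vertex P i" "vertex P (i mod n + 1) = vertex P (Suc i)"
    "vertex P (i mod n + 2) = vertex P (Suc (Suc i))"
    by (auto simp: vertex_def mod_Suc_eq mod_Suc_Suc_eq)
  moreover have "\<not> collinear {vertex P (i mod n), vertex P (i mod n + 1), vertex P (i mod n + 2)}"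
    using assms by (simp add: hpolygon_def)
  ultimately show ?thesis by simp
qed

lemma vertex_neq_Suc:
  assumes "hpolygon n P" "0 < n" shows "vertex P i \<noteq> vertex P (Suc i)"
  using hpolygon_not_collinear[OF assms, of i] by auto

text \<open>One of three collinear points lies between the others, and betweenness is respected
  because segments go to segments.\<close>

lemma half_turn_collinear:
  assumes c: "c \<in> hplane" and S: "x \<in> hplane" "y \<in> hplane" "z \<in> hplane"
    and col: "collinear {half_turn c x, half_turn c y, half_turn c z}"
  shows "collinear {x, y, z}"
proof -
  have mem: "u \<in> closed_segment v w" if "half_turn c u \<in> closed_segment (half_turn c v) (half_turn c w)"
    "u \<in> hplane" "v \<in> hplane" "w \<in> hplane" for u v w
  proof -
    have "half_turn c u \<in> half_turn c ` closed_segment v w"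
      using that half_turn_closed_segment[OF c] by simp
    then show ?thesis
      using that inj_on_half_turn[OF c order_refl] closed_segment_hplane[of v w]
      by (metis inj_on_image_mem_iff)
  qed
  show ?thesis
    using col S mem unfolding collinear_between_cases between_mem_segment by blast
qed

lemma collinear_inner_eq:
  fixes t :: "real^2"
  assumes "t \<noteq> 0" "\<And>x. x \<in> S \<Longrightarrow> t \<bullet> x = a"
  shows "collinear S"
proof -
  define e where "e = (1 / norm t) *\<^sub>R t"
  define f :: "real^2" where "f = vector [- (e $ 2), e $ 1]"
  have e: "e \<bullet> e = 1" using assms(1) by (simp add: e_def dot_square_norm power2_eq_square)
  have f: "f \<bullet> f = 1" "e \<bullet> f = 0" using e by (auto simp: f_def inner_vec_2)
  have x: "x = (a / norm t) *\<^sub>R e + (x \<bullet> f) *\<^sub>R f" if "x \<in> S" for x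
  proof -
    have "x \<bullet> e = a / norm t" using assms(2)[OF that] by (simp add: e_def inner_commute)
    then show ?thesis using inner_orthonormal_expansion[OF e f, of x] by simp
  qed
  have "\<exists>c. x - y = c *\<^sub>R f" if "x \<in> S" "y \<in> S" for x y
  proof
    show "x - y = (x \<bullet> f - y \<bullet> f) *\<^sub>R f"
      by (subst x[OF that(1)], subst x[OF that(2)]) (simp add: scaleR_diff_left inner_add_left f)
  qed
  then show ?thesis unfolding collinear_def by blast
qed

lemma side_tangent_point:
  assumes n: "0 < n" and P: "hpolygon n P" and c: "is_incircle P c r"
  defines "W \<equiv> \<lambda>i. half_turn c (vertex P i)"
  obtains t where "t \<in> closed_segment (W i) (W (Suc i))" "norm t = tanh r"
    "t \<bullet> W i = (tanh r)\<^sup>2" "t \<bullet> W (Suc i) = (tanh r)\<^sup>2"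
proof -
  have len: "length P = n" using P by (simp add: hpolygon_def)
  have ch: "c \<in> hplane" and r: "r > 0" using c by (auto simp: is_incircle_def)
  have v: "vertex P i \<in> hplane" for i using vertex_in_hplane[OF P n] .
  have "side_tangent P (i mod n) (hcircle c r)" using c n by (simp add: is_incircle_def len)
  then have "side_tangent P i (hcircle c r)"
    using vertex_mod[of P i] vertex_Suc_mod[of P i] side_mod[of P i]
    by (simp add: side_tangent_def len)
  then obtain p where p: "p \<in> side P i" "hline (vertex P i) (vertex P (Suc i)) \<inter> hcircle c r = {p}"
    by (auto simp: side_tangent_def)
  have ph: "p \<in> hplane" "hdist c p = r" using p(2) by (auto simp: hcircle_def)
  have circ: "norm (half_turn c x) = tanh r \<longleftrightarrow> hdist c x = r" if "x \<in> hplane" for x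
    using half_turn_hdist[OF ch ch that] hdist_zero_eq_iff[OF half_turn_in_hplane[OF ch that]] r
    by (simp add: half_turn_center[OF ch])
  define t where "t = half_turn c p"
  have t: "t \<in> closed_segment (W i) (W (Suc i))"
    using p(1) half_turn_closed_segment[OF ch v v, of i "Suc i"] by (auto simp: t_def W_def side_def)
  have nt: "norm t = tanh r" using circ[OF ph(1)] ph(2) by (simp add: t_def)
  have ne: "W i \<noteq> W (Suc i)"
    using vertex_neq_Suc[OF P n, of i] inj_on_half_turn[OF ch order_refl] v
    by (auto simp: W_def inj_on_def)
  have un: "y = t" if y: "y \<in> hline (W i) (W (Suc i))" "norm y = tanh r" for y
  proof -
    have "y \<in> half_turn c ` hline (vertex P i) (vertex P (Suc i))"
      using y(1) half_turn_hline[OF ch v v, of i "Suc i"] by (simp add: W_def)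
    then obtain z where z: "y = half_turn c z" "z \<in> hline (vertex P i) (vertex P (Suc i))" by blast
    then have zh: "z \<in> hplane" using hline_subset by blast
    then have "z \<in> hcircle c r" using circ[OF zh] y(2) z(1) by (simp add: hcircle_def)
    then show ?thesis using z p(2) by (auto simp: t_def)
  qed
  show ?thesis
    by (rule that[OF t nt tangent_point_orthogonal[OF ne t nt tanh_real_lt_1 un]])
qed

lemma add_mod_neq:
  fixes i k n d :: nat
  assumes "i + d < k" "k < i + d + n"
  shows "k mod n \<noteq> (i + d) mod n"
proof
  assume "k mod n = (i + d) mod n"
  moreover have "i + d \<le> k" using assms by simp
  ultimately have "n dvd k - (i + d)" by (metis mod_eq_dvd_iff_nat)
  then have "n \<le> k - (i + d)" using assms(1) by (intro dvd_imp_le) simp_all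
  then show False using assms by linarith
qed

lemma tangential_polygon_fan:
  assumes n: "3 \<le> n" and P: "hpolygon n P" and c: "is_incircle P c r"
  obtains f1 f2 \<alpha> where "tangential_fan f1 f2 (tanh r) n \<alpha>" "\<And>k. tanh r < cos (\<alpha> k)"
    "\<And>k. half_turn c (vertex P k) = tangential_fan.V f1 f2 (tanh r) \<alpha> k"
    "tangential_fan.ang \<alpha> n = 2 * pi"
proof -
  have len: "length P = n" using P by (simp add: hpolygon_def)
  have n0: "0 < n" using n by simp
  have ch: "c \<in> hplane" and r: "r > 0" using c by (auto simp: is_incircle_def)
  have v: "vertex P i \<in> hplane" for i using vertex_in_hplane[OF P n0] .
  define W where "W i = half_turn c (vertex P i)" for i
  have q: "0 < tanh r" using r by simp
  have "\<exists>t. t \<in> closed_segment (W i) (W (Suc i)) \<and> norm t = tanh r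
      \<and> t \<bullet> W i = (tanh r)\<^sup>2 \<and> t \<bullet> W (Suc i) = (tanh r)\<^sup>2" for i
    using side_tangent_point[OF n0 P c, of i] unfolding W_def by metis
  then obtain t where t: "\<And>i. t i \<in> closed_segment (W i) (W (Suc i))" "\<And>i. norm (t i) = tanh r"
      "\<And>i. t i \<bullet> W i = (tanh r)\<^sup>2" "\<And>i. t i \<bullet> W (Suc i) = (tanh r)\<^sup>2" by metis
  \<comment> \<open>Equal tangency points would put three consecutive vertices on one tangent
    line.\<close>
  have tt: "t k \<noteq> t (Suc k)" for k
  proof
    assume e: "t k = t (Suc k)"
    have "t k \<noteq> 0" using t(2)[of k] q by auto
    moreover have "t k \<bullet> x = (tanh r)\<^sup>2" if "x \<in> {W k, W (Suc k), W (Suc (Suc k))}" for x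
      using that t(3,4)[of k] t(4)[of "Suc k"] e by auto
    ultimately have "collinear {W k, W (Suc k), W (Suc (Suc k))}" by (rule collinear_inner_eq)
    then have "collinear {vertex P k, vertex P (Suc k), vertex P (Suc (Suc k))}"
      unfolding W_def by (rule half_turn_collinear[OF ch v v v])
    then show False using hpolygon_not_collinear[OF P n0] by blast
  qed
  have per: "W (k + n) = W k" for k by (simp add: W_def vertex_def len)
  have W1: "norm (W k) < 1" for k
    using half_turn_in_hplane[OF ch v[of k]] by (simp add: W_def hplane_def)
  obtain f1 f2 \<alpha> where fan: "tangential_fan f1 f2 (tanh r) n \<alpha>" and cos: "\<And>k. tanh r < cos (\<alpha> k)"
    and WV: "\<And>k. W k = tangential_fan.V f1 f2 (tanh r) \<alpha> k"
    using tangent_chain_fan[OF q n0 per t(1) t(2) t(3) t(4) tt W1] by metis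
  interpret F: tangential_fan f1 f2 "tanh r" n \<alpha> by (rule fan)
  have "F.V n = F.V 0" using per[of 0] by (simp add: WV)
  then have "F.E (F.ang n) = F.E 0"
    using F.\<alpha>_periodic[of 0] q F.cos_\<alpha>_pos[of 0] by (simp add: F.V_def)
  then obtain m :: int where m: "F.ang n = m * 2 * pi" by (auto simp: F.E_eq_iff)
  have "0 < m * (2 * pi)" using F.ang_n_pos m by (simp add: mult.assoc)
  then have m0: "0 < m" by (simp add: zero_less_mult_iff)
  have "\<not> 2 \<le> m"
  proof
    assume "2 \<le> m"
    then have "F.ang n = 2 * pi * real (nat m)" "2 \<le> nat m" using m by auto
    then obtain i k where ik: "i + 2 \<le> k" "k + 2 \<le> i + n"
      and int: "closed_segment (F.V i) (F.V (Suc i)) \<inter> closed_segment (F.V k) (F.V (Suc k)) \<noteq> {}"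
      by (rule F.winding_imp_crossing)
    have seg: "closed_segment (F.V j) (F.V (Suc j)) = half_turn c ` side P j" for j
      using half_turn_closed_segment[OF ch v v, of j "Suc j"] by (simp add: side_def flip: WV W_def)
    have sub: "side P j \<subseteq> hplane" for j unfolding side_def by (rule closed_segment_hplane[OF v v])
    have "side P i \<inter> side P k \<noteq> {}"
      using int unfolding seg
      by (metis inj_on_image_Int inj_on_half_turn[OF ch order_refl] sub image_empty)
    \<comment> \<open>The bounds on \<open>k\<close> keep it away from \<open>i\<close> and from
      both its neighbours modulo \<open>n\<close>, so simplicity applies to the two sides.\<close>
    moreover have "side P (i mod n) \<inter> side P (k mod n) = {}"
    proof -
      have "k mod n \<noteq> (i + 0) mod n" "k mod n \<noteq> (i + 1) mod n" "(i + n) mod n \<noteq> (k + 1) mod n"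
        using ik by (intro add_mod_neq; simp)+
      then have "i mod n \<noteq> k mod n" "k mod n \<noteq> (i mod n + 1) mod n" "i mod n \<noteq> (k mod n + 1) mod n"
        by (auto simp: mod_Suc_eq)
      then show ?thesis using P n0 by (simp add: hpolygon_def)
    qed
    ultimately show False using side_mod[of P i] side_mod[of P k] by (simp add: len)
  qed
  then have "m = 1" using m0 by simp
  then have "F.ang n = 2 * pi" using m by simp
  then show ?thesis using that fan cos WV unfolding W_def by blast
qed

section \<open>The area inequality\<close>

lemma half_turn_convex:
  assumes c: "c \<in> hplane" and S: "convex S" "S \<subseteq> hplane"
  shows "convex (half_turn c ` S)"
  unfolding convex_contains_segment
proof (intro ballI)
  fix a b assume "a \<in> half_turn c ` S" "b \<in> half_turn c ` S"
  then obtain x y where xy: "a = half_turn c x" "b = half_turn c y" "x \<in> S" "y \<in> S" by blast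
  then have "closed_segment a b = half_turn c ` closed_segment x y"
    using half_turn_closed_segment[OF c] S(2) by (metis subsetD)
  then show "closed_segment a b \<subseteq> half_turn c ` S"
    using closed_segment_subset[OF xy(3,4) S(1)] by blast
qed

lemma continuous_on_half_turn: "c \<in> hplane \<Longrightarrow> continuous_on hplane (half_turn c)"
  by (meson half_turn_has_derivative has_derivative_at_withinI has_derivative_continuous_on)

text \<open>The image under an involution is also the preimage, so continuity gives
  openness.\<close>

lemma half_turn_open:
  assumes c: "c \<in> hplane" and U: "open U" "U \<subseteq> hplane"
  shows "open (half_turn c ` U)"
proof -
  have "half_turn c ` U = hplane \<inter> half_turn c -` U"
    using half_turn_half_turn[OF c] half_turn_in_hplane[OF c] U(2)
    by (auto simp: subset_iff image_iff) metis
  then show ?thesis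
    using continuous_open_preimage[OF continuous_on_half_turn[OF c] _ U(1)] by (simp add: hplane_def)
qed

lemma half_turn_interior:
  assumes c: "c \<in> hplane" and S: "S \<subseteq> hplane"
  shows "interior (half_turn c ` S) = half_turn c ` interior S"
proof -
  have sub: "half_turn c ` interior T \<subseteq> interior (half_turn c ` T)" if "T \<subseteq> hplane" for T
    using interior_subset[of T] that by (intro interior_maximal half_turn_open[OF c] image_mono) auto
  have "half_turn c ` interior (half_turn c ` S) \<subseteq> interior S"
    using sub[OF half_turn_image_hplane_subset[OF c S]] half_turn_image_involution[OF c S] by simp
  then have "half_turn c ` half_turn c ` interior (half_turn c ` S) \<subseteq> half_turn c ` interior S"
    by blast
  moreover have "interior (half_turn c ` S) \<subseteq> hplane"
    using interior_subset half_turn_image_hplane_subset[OF c S] by blast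
  ultimately show ?thesis
    using sub[OF S] half_turn_image_involution[OF c] by (metis subset_antisym)
qed

lemma half_turn_compact:
  assumes c: "c \<in> hplane" and S: "compact S" "S \<subseteq> hplane"
  shows "compact (half_turn c ` S)"
  using S continuous_on_half_turn[OF c] by (metis compact_continuous_image continuous_on_subset)

lemma half_turn_frontier:
  assumes c: "c \<in> hplane" and S: "compact S" "S \<subseteq> hplane"
  shows "frontier (half_turn c ` S) = half_turn c ` frontier S"
proof -
  have "frontier (half_turn c ` S) = half_turn c ` S - half_turn c ` interior S"
    using half_turn_compact[OF c S]
    by (simp add: frontier_def compact_imp_closed half_turn_interior[OF c S(2)])
  also have "\<dots> = half_turn c ` (S - interior S)"
    by (rule inj_on_image_set_diff[OF inj_on_half_turn[OF c S(2)], symmetric]) (auto intro: interior_subset[THEN subsetD])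
  finally show ?thesis using S(1) by (simp add: frontier_def compact_imp_closed)
qed

lemma interior_angle_convex:
  assumes bd: "boundary P = frontier S" and S: "bounded S" "convex S"
    and v: "vertex P (i + length P - 1) \<in> S" "vertex P i \<in> S" "vertex P (i + 1) \<in> S"
    and nc: "\<not> collinear {vertex P i, vertex P (i + length P - 1), vertex P (i + 1)}"
  shows "interior_angle P i = hangle (vertex P i) (vertex P (i + length P - 1) - vertex P i)
    (vertex P (i + 1) - vertex P i)"
proof -
  have dim2: "DIM(real^2) = 2" by simp
  define x a b where "x = vertex P i" and "a = vertex P (i + length P - 1)" and "b = vertex P (i + 1)"
  \<comment> \<open>In the triangle of the vertex and its neighbours the point has weights
    \<open>1 - 2 * t\<close>, \<open>t\<close>, \<open>t\<close>, all positive for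
    \<open>t < 1 / 2\<close>; by convexity this triangle lies in \<open>S\<close>.\<close>
  have "x + t *\<^sub>R ((a - x) + (b - x)) \<in> inside (boundary P)" if t: "0 < t" "t < 1 / 2" for t
  proof -
    have "x + t *\<^sub>R ((a - x) + (b - x)) = (1 - 2 * t) *\<^sub>R x + t *\<^sub>R a + t *\<^sub>R b"
      by (simp add: algebra_simps flip: scaleR_2)
    also have "\<dots> \<in> interior (convex hull {x, a, b})"
      unfolding interior_convex_hull_3_minimal[OF nc[folded x_def a_def b_def] dim2]
      using t by (intro CollectI exI[of _ "1 - 2 * t"] exI[of _ t] conjI) simp_all
    also have "\<dots> \<subseteq> interior S"
      using v S(2) by (intro interior_mono hull_minimal) (auto simp: x_def a_def b_def)
    finally show ?thesis by (simp add: bd inside_frontier_eq_interior[OF S])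
  qed
  then have "\<exists>e>0. \<forall>t. 0 < t \<and> t < e \<longrightarrow> x + t *\<^sub>R ((a - x) + (b - x)) \<in> inside (boundary P)"
    by (intro exI[of _ "1/2"]) simp
  then show ?thesis by (simp add: interior_angle_def Let_def x_def a_def b_def)
qed

section \<open>Interior angles and side lengths of a fan\<close>

context tangential_fan
begin

text \<open>The sides at the vertex point towards their tangency points, so only
  \<open>\<alpha> (Suc k)\<close> matters. The argument is \<open>1 - 2 * (sin b)^2\<close> for half
  the angle \<open>b\<close>, where \<open>cos b = sin (\<alpha> (Suc k)) / sqrt (1 - q^2)\<close>
  as in the right triangle.\<close>

lemma hangle_at_vertex:
  assumes q: "\<And>k. q < cos (\<alpha> k)"
  shows "hangle (V (Suc k)) (V k - V (Suc k)) (V (Suc (Suc k)) - V (Suc k))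
    = arccos (1 - 2 * ((cos (\<alpha> (Suc k)))\<^sup>2 - q\<^sup>2) / (1 - q\<^sup>2))"
proof -
  define X T T' where "X = V (Suc k)" and "T = q *\<^sub>R E (\<Theta> k)" and "T' = q *\<^sub>R E (\<Theta> (Suc k))"
  \<comment> \<open>Ratios of the full sides to their tangent segments at the vertex; positive
    factors do not change the angle.\<close>
  define a b where "a = (tan (\<alpha> k) + tan (\<alpha> (Suc k))) / tan (\<alpha> (Suc k))"
    and "b = (tan (\<alpha> (Suc k)) + tan (\<alpha> (Suc (Suc k)))) / tan (\<alpha> (Suc k))"
  have tp: "0 < tan (\<alpha> j)" for j by (rule tan_\<alpha>_pos)
  have ab: "0 < a" "0 < b" using tp by (auto simp: a_def b_def intro!: divide_pos_pos add_pos_pos)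
  have "V k - V (Suc k) = - ((tan (\<alpha> k) + tan (\<alpha> (Suc k))) *\<^sub>R (q *\<^sub>R E (\<Theta> k + pi / 2)))"
    unfolding V_left[of k] V_right[of k] by (simp add: algebra_simps)
  also have "tan (\<alpha> k) + tan (\<alpha> (Suc k)) = a * tan (\<alpha> (Suc k))"
    using tp[of "Suc k"] by (simp add: a_def)
  also have "- ((a * tan (\<alpha> (Suc k))) *\<^sub>R (q *\<^sub>R E (\<Theta> k + pi / 2))) = a *\<^sub>R (T - X)"
    unfolding X_def T_def V_right[of k] by simp
  finally have 1: "V k - V (Suc k) = a *\<^sub>R (T - X)" .
  have "V (Suc (Suc k)) - V (Suc k) = (tan (\<alpha> (Suc k)) + tan (\<alpha> (Suc (Suc k)))) *\<^sub>R (q *\<^sub>R E (\<Theta> (Suc k) + pi / 2))"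
    unfolding V_left[of "Suc k"] V_right[of "Suc k"] by (simp add: algebra_simps)
  also have "tan (\<alpha> (Suc k)) + tan (\<alpha> (Suc (Suc k))) = b * tan (\<alpha> (Suc k))"
    using tp[of "Suc k"] by (simp add: b_def)
  also have "(b * tan (\<alpha> (Suc k))) *\<^sub>R (q *\<^sub>R E (\<Theta> (Suc k) + pi / 2)) = b *\<^sub>R (T' - X)"
    unfolding X_def T'_def V_left[of "Suc k"] by simp
  finally have 2: "V (Suc (Suc k)) - V (Suc k) = b *\<^sub>R (T' - X)" .
  define C A D where "C = (cos (\<alpha> (Suc k)))\<^sup>2" and "A = (C - q\<^sup>2) / C" and "D = 1 - q\<^sup>2"
  have c0: "0 < cos (\<alpha> (Suc k))" by (rule cos_\<alpha>_pos)
  have sin0: "0 < sin (\<alpha> (Suc k))" using \<alpha>_pos[of "Suc k"] \<alpha>_less[of "Suc k"] by (intro sin_gt_zero) auto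
  then have C1: "C < 1" by (simp add: C_def cos_squared_eq)
  have C0: "0 < C" using c0 by (simp add: C_def)
  have qC: "q\<^sup>2 < C" using q[of "Suc k"] q_pos unfolding C_def by (intro power_strict_mono) auto
  have A: "0 < A" using qC C0 by (simp add: A_def)
  have D: "0 < D" using qC C1 by (simp add: D_def)
  have DA: "D - A = q\<^sup>2 * (1 - C) / C" using C0 by (simp add: A_def D_def field_simps)
  then have DA0: "0 < D - A" using C0 C1 q_pos by simp
  have XX: "1 - X \<bullet> X = A"
    using c0 by (simp add: X_def V_def E_inner A_def C_def diff_divide_distrib power2_eq_square)
  have XT: "X \<bullet> T = q\<^sup>2"
    using E_\<Theta>_inner_V(2)[of k] by (simp add: X_def T_def inner_commute[of "V (Suc k)"] power2_eq_square)
  have XT': "X \<bullet> T' = q\<^sup>2"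
    using E_\<Theta>_inner_V(1)[of "Suc k"] by (simp add: X_def T'_def inner_commute[of "V (Suc k)"] power2_eq_square)
  have TT: "T \<bullet> T = q\<^sup>2" "T' \<bullet> T' = q\<^sup>2"
    by (simp_all add: T_def T'_def E_inner power2_eq_square)
  have "cos (\<Theta> k - \<Theta> (Suc k)) = 2 * C - 1"
    by (simp add: \<Theta>_Suc C_def cos_double_cos)
  then have TT': "T \<bullet> T' = q\<^sup>2 * (2 * C - 1)"
    by (simp add: T_def T'_def E_inner power2_eq_square)
  have h1: "hinner X (T - X) (T' - X) = (D * D - A * (1 - q\<^sup>2 * (2 * C - 1))) / A\<^sup>2"
    unfolding hinner_chords XX XT XT' TT' by (simp add: D_def)
  have h2: "hinner X (T - X) (T - X) = D * (D - A) / A\<^sup>2" "hinner X (T' - X) (T' - X) = D * (D - A) / A\<^sup>2"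
    unfolding hinner_chords XX XT XT' TT by (simp_all add: D_def[symmetric] algebra_simps)
  have "hangle (V (Suc k)) (V k - V (Suc k)) (V (Suc (Suc k)) - V (Suc k)) = hangle X (T - X) (T' - X)"
    unfolding 1 2 unfolding X_def[symmetric] by (rule hangle_scaleR[OF ab])
  also have "\<dots> = arccos ((D * D - A * (1 - q\<^sup>2 * (2 * C - 1))) / A\<^sup>2 / (D * (D - A) / A\<^sup>2))"
    unfolding hangle_def h1 h2 using A D DA0 by simp
  also have "(D * D - A * (1 - q\<^sup>2 * (2 * C - 1))) / A\<^sup>2 / (D * (D - A) / A\<^sup>2)
    = (D * D - A * (1 - q\<^sup>2 * (2 * C - 1))) / (D * (D - A))"
    using A by simp
  also have "D * D - A * (1 - q\<^sup>2 * (2 * C - 1)) = D * (D - A) - 2 * (C - q\<^sup>2) * (D - A)"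
  proof -
    have "(C - q\<^sup>2) * (D - A) = A * (q\<^sup>2 * (1 - C))" unfolding DA using C0 by (simp add: A_def)
    then show ?thesis by (simp add: D_def algebra_simps)
  qed
  also have "(D * (D - A) - 2 * (C - q\<^sup>2) * (D - A)) / (D * (D - A)) = 1 - 2 * (C - q\<^sup>2) / D"
    using D DA0 by (simp add: diff_divide_distrib)
  finally show ?thesis by (simp add: C_def D_def)
qed

lemma hdist_sides_equal:
  assumes "\<And>k. \<alpha> k = a"
  shows "hdist (V i) (V (Suc i)) = hdist (V j) (V (Suc j))"
proof -
  have "V i \<bullet> V (Suc i) = V j \<bullet> V (Suc j)"
    by (simp add: V_def E_inner ang_Suc assms)
  moreover have "norm (V i) = \<bar>q / cos a\<bar>" for i by (simp add: V_def assms)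
  ultimately show ?thesis by (simp add: hdist_def)
qed

end

section \<open>Strict concavity and Jensen's inequality\<close>

lemma arccos_sin_tangent_line:
  fixes C :: real
  assumes C: "1 < C" and m: "0 < m" "m < pi / 2" "C * sin m < 1"
    and x: "0 < x" "x < pi / 2" "C * sin x < 1" and ne: "x \<noteq> m"
  shows "arccos (C * sin x) < arccos (C * sin m) - C * cos m / sqrt (1 - (C * sin m)\<^sup>2) * (x - m)"
proof -
  \<comment> \<open>The derivative is \<open>- D\<close>, so strict concavity means that
    \<open>D\<close> increases strictly; the mean value theorem on either side of \<open>m\<close>
    then puts the graph below the tangent.\<close>
  define D where "D z = C * cos z / sqrt (1 - (C * sin z)\<^sup>2)" for z
  \<comment> \<open>Both points lie in the interval from 0 to \<open>M\<close>, on which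
    \<open>C * sin z\<close> stays below 1 and \<open>arccos\<close> is differentiable.\<close>
  define M where "M = max x m"
  have M: "0 < M" "M < pi / 2" "C * sin M < 1" using m x by (auto simp: M_def max_def)
  have dom: "0 < C * sin z" "C * sin z < 1" "0 < cos z" "0 < sin z" if "0 < z" "z \<le> M" for z
  proof -
    show s: "0 < sin z" using that M by (intro sin_gt_zero) auto
    show "0 < cos z" using that M by (intro cos_gt_zero_pi) auto
    show "0 < C * sin z" using s C by simp
    have "sin z \<le> sin M" using that M by (intro sin_monotone_2pi_le) auto
    then have "C * sin z \<le> C * sin M" using C by (intro mult_left_mono) auto
    then show "C * sin z < 1" using M by linarith
  qed
  have der: "((\<lambda>x. arccos (C * sin x)) has_real_derivative - D z) (at z)" if "0 < z" "z \<le> M" for z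
    using dom[OF that] by (auto intro!: derivative_eq_intros simp: D_def divide_simps)
  have mono: "D y < D z" if yz: "0 < y" "y < z" "z \<le> M" for y z
  \<comment> \<open>Squaring removes the roots: the square of \<open>D z\<close> is a fractional
    linear function of the square of \<open>sin z\<close>, increasing because
    \<open>C > 1\<close>.\<close>
  proof (rule power_less_imp_less_base[where n=2])
    define u w where "u = (sin y)\<^sup>2" and "w = (sin z)\<^sup>2"
    have dy: "0 < C * sin y" "C * sin y < 1" "0 < cos y" "0 < sin y" using dom[of y] yz by auto
    have dz: "0 < C * sin z" "C * sin z < 1" "0 < cos z" "0 < sin z" using dom[of z] yz by auto
    have "sin y < sin z" using yz M by (intro sin_monotone_2pi) auto
    then have uw: "u < w" unfolding u_def w_def using dy by (intro power_strict_mono) auto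
    have cw: "C\<^sup>2 * w < 1" using dz by (simp add: w_def abs_square_less_1 flip: power_mult_distrib)
    have cu: "C\<^sup>2 * u < 1" using dy by (simp add: u_def abs_square_less_1 flip: power_mult_distrib)
    have "(w - u) * 1 < (w - u) * C\<^sup>2" using uw C by (intro mult_strict_left_mono) (auto simp: one_less_power)
    then have "(1 - u) * (1 - C\<^sup>2 * w) < (1 - w) * (1 - C\<^sup>2 * u)" by (simp add: algebra_simps)
    then have "(1 - u) / (1 - C\<^sup>2 * u) < (1 - w) / (1 - C\<^sup>2 * w)"
      using cu cw by (simp add: divide_less_eq pos_less_divide_eq mult.commute)
    then have "C\<^sup>2 * ((1 - u) / (1 - C\<^sup>2 * u)) < C\<^sup>2 * ((1 - w) / (1 - C\<^sup>2 * w))"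
      using C by (intro mult_strict_left_mono) auto
    moreover have "(D y)\<^sup>2 = C\<^sup>2 * ((1 - u) / (1 - C\<^sup>2 * u))"
      using cu by (simp add: D_def power_divide power_mult_distrib u_def cos_squared_eq)
    moreover have "(D z)\<^sup>2 = C\<^sup>2 * ((1 - w) / (1 - C\<^sup>2 * w))"
      using cw by (simp add: D_def power_divide power_mult_distrib w_def cos_squared_eq)
    ultimately show "(D y)\<^sup>2 < (D z)\<^sup>2" by simp
    show "0 \<le> D z" using dz C cw by (simp add: D_def power_mult_distrib w_def)
  qed
  have "arccos (C * sin x) < arccos (C * sin m) - D m * (x - m)"
  proof (cases "m < x")
    case True
    obtain z where z: "m < z" "z < x"
      "arccos (C * sin x) - arccos (C * sin m) = (x - m) * (- D z)"
      using MVT2[OF True, of "\<lambda>x. arccos (C * sin x)" "\<lambda>z. - D z"] der m True by (auto simp: M_def)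
    have "D m < D z" using z m by (intro mono) (auto simp: M_def)
    then have "(x - m) * D m < (x - m) * D z" using True by (intro mult_strict_left_mono) auto
    then show ?thesis using z(3) by (simp add: algebra_simps)
  next
    case False
    then have xm: "x < m" using ne by simp
    obtain z where z: "x < z" "z < m"
      "arccos (C * sin m) - arccos (C * sin x) = (m - x) * (- D z)"
      using MVT2[OF xm, of "\<lambda>x. arccos (C * sin x)" "\<lambda>z. - D z"] der x xm by (auto simp: M_def)
    have "D z < D m" using z x by (intro mono) (auto simp: M_def)
    then have "(m - x) * D z < (m - x) * D m" using xm by (intro mult_strict_left_mono) auto
    then show ?thesis using z(3) by (simp add: algebra_simps)
  qed
  then show ?thesis by (simp add: D_def)
qed

text \<open>The tangent is taken at the mean \<open>pi / n\<close>, so its linear terms sum to 0;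
  its strictness elsewhere settles the equality case.\<close>

lemma sum_arccos_sin_le:
  fixes \<alpha> :: "nat \<Rightarrow> real"
  assumes C: "1 < C" and n: "3 \<le> n" and sum: "(\<Sum>k<n. \<alpha> k) = pi"
    and \<alpha>: "\<And>k. 0 < \<alpha> k" "\<And>k. \<alpha> k < pi / 2" "\<And>k. C * sin (\<alpha> k) < 1"
  shows "(\<Sum>k<n. arccos (C * sin (\<alpha> k))) \<le> n * arccos (C * sin (pi / n))"
    and "(\<Sum>k<n. arccos (C * sin (\<alpha> k))) = n * arccos (C * sin (pi / n)) \<longleftrightarrow> (\<forall>k<n. \<alpha> k = pi / n)"
proof -
  define m where "m = pi / n"
  have nm: "n * m = pi" using n by (simp add: m_def)
  have "pi / n \<le> pi / 3" using n by (intro divide_left_mono) auto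
  then have "m < pi / 2" using pi_gt_zero unfolding m_def by linarith
  moreover have "0 < m" using n by (simp add: m_def)
  ultimately have m: "0 < m" "m < pi / 2" by auto
  \<comment> \<open>The tangent at the mean requires \<open>C * sin m < 1\<close>. Some
    \<open>\<alpha> k\<close> is at least the mean, and its bound passes down to \<open>m\<close> by
    monotonicity of \<open>sin\<close>.\<close>
  obtain k where "k < n" "m \<le> \<alpha> k"
  proof (rule ccontr)
    assume "\<not> thesis"
    then have "\<alpha> k < m" if "k < n" for k using that \<open>\<And>k. k < n \<Longrightarrow> m \<le> \<alpha> k \<Longrightarrow> thesis\<close> by force
    then have "(\<Sum>k<n. \<alpha> k) < (\<Sum>k<n. m)" using n by (intro sum_strict_mono) (auto simp: lessThan_empty_iff)
    then show False using sum nm by simp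
  qed
  then have "sin m \<le> sin (\<alpha> k)" using m \<alpha>(2)[of k] by (intro sin_monotone_2pi_le) auto
  then have "C * sin m \<le> C * sin (\<alpha> k)" using C by (intro mult_left_mono) auto
  then have Cm: "C * sin m < 1" using \<alpha>(3)[of k] by linarith
  define d where "d = C * cos m / sqrt (1 - (C * sin m)\<^sup>2)"
  have tl: "arccos (C * sin (\<alpha> k)) \<le> arccos (C * sin m) - d * (\<alpha> k - m)" for k
    using arccos_sin_tangent_line[OF C m Cm \<alpha>, of k] unfolding d_def by (cases "\<alpha> k = m") auto
  have S: "(\<Sum>k<n. arccos (C * sin m) - d * (\<alpha> k - m)) = n * arccos (C * sin m)"
    using sum nm by (simp add: sum_subtractf flip: sum_distrib_left)
  then show "(\<Sum>k<n. arccos (C * sin (\<alpha> k))) \<le> n * arccos (C * sin (pi / n))"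
    using sum_mono[of "{..<n}" "\<lambda>k. arccos (C * sin (\<alpha> k))", OF tl] by (simp add: m_def)
  show "(\<Sum>k<n. arccos (C * sin (\<alpha> k))) = n * arccos (C * sin (pi / n)) \<longleftrightarrow> (\<forall>k<n. \<alpha> k = pi / n)"
  proof
    assume eq: "(\<Sum>k<n. arccos (C * sin (\<alpha> k))) = n * arccos (C * sin (pi / n))"
    show "\<forall>k<n. \<alpha> k = pi / n"
    proof (rule ccontr)
      assume "\<not> (\<forall>k<n. \<alpha> k = pi / n)"
      then obtain k where k: "k < n" "\<alpha> k \<noteq> m" by (auto simp: m_def)
      have "arccos (C * sin (\<alpha> k)) < arccos (C * sin m) - d * (\<alpha> k - m)"
        using arccos_sin_tangent_line[OF C m Cm \<alpha> k(2)] by (simp add: d_def)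
      then have "(\<Sum>k<n. arccos (C * sin (\<alpha> k))) < (\<Sum>k<n. arccos (C * sin m) - d * (\<alpha> k - m))"
        using k tl by (intro sum_strict_mono_ex1) auto
      then show False using eq S by (simp add: m_def)
    qed
  qed simp
qed

theorem theorem1p4:
  fixes n :: nat and P :: "(real^2) list" and c :: "real^2" and r :: real
  assumes "n \<ge> 3"
    and "hpolygon n P"
    and "is_incircle P c r"
  shows "harea (region P) \<ge> (real n - 2) * pi - 2 * real n * arccos (sin (pi / real n) * cosh r) \<and>
    (harea (region P) = (real n - 2) * pi - 2 * real n * arccos (sin (pi / real n) * cosh r)
       \<longleftrightarrow> regular P)"
proof -
  have len: "length P = n" using assms(2) by (simp add: hpolygon_def)
  have n0: "0 < n" using assms(1) by simp
  have ch: "c \<in> hplane" and r: "r > 0" using assms(3) by (auto simp: is_incircle_def)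
  have v: "vertex P i \<in> hplane" for i using vertex_in_hplane[OF assms(2) n0] .
  define q where "q = tanh r"
  obtain f1 f2 \<alpha> where fan: "tangential_fan f1 f2 q n \<alpha>" and q: "\<And>k. q < cos (\<alpha> k)"
    and hV: "\<And>k. half_turn c (vertex P k) = tangential_fan.V f1 f2 q \<alpha> k"
    and ang: "tangential_fan.ang \<alpha> n = 2 * pi"
    using tangential_polygon_fan[OF assms] unfolding q_def by metis
  interpret F: tangential_fan f1 f2 q n \<alpha> by (rule fan)
  have vV: "vertex P k = half_turn c (F.V k)" for k
    using half_turn_half_turn[OF ch v[of k]] by (simp add: hV)
  have Vh: "F.V k \<in> hplane" for k using half_turn_in_hplane[OF ch v[of k]] by (simp add: hV)
  note H = F.halfplanes_compact[OF ang q]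
  define S where "S = half_turn c ` F.halfplanes"
  have "side P k = half_turn c ` closed_segment (F.V k) (F.V (Suc k))" for k
    using half_turn_closed_segment[OF ch Vh Vh] by (simp add: side_def vV)
  then have bd: "boundary P = frontier S"
    by (simp add: boundary_def len S_def half_turn_frontier[OF ch H] F.frontier_halfplanes[OF ang] image_UN)
  have S: "compact S" "convex S"
    unfolding S_def by (intro half_turn_compact[OF ch H] half_turn_convex[OF ch F.convex_halfplanes H(2)])+
  have bS: "bounded S" using S(1) by (rule compact_imp_bounded)
  \<comment> \<open>The inside of the frontier of a bounded convex set is its interior, and adding
    the frontier recovers the closed set \<open>S\<close>.\<close>
  have "region P = S"
    unfolding region_def bd inside_frontier_eq_interior[OF bS S(2)]
    using compact_imp_closed[OF S(1)] by (metis closure_Un_frontier closure_closed frontier_def Diff_partition Un_commute closure_subset interior_subset order_trans)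
  define C where "C = cosh r"
  have C: "1 < C" using r cosh_real_strict_mono[of 0 r] by (simp add: C_def)
  have Cq: "1 - q\<^sup>2 = 1 / C\<^sup>2"
  proof -
    have "1 - q\<^sup>2 = (C\<^sup>2 - (sinh r)\<^sup>2) / C\<^sup>2"
      using C by (simp add: q_def tanh_def power_divide diff_divide_distrib C_def)
    then show ?thesis by (simp add: C_def cosh_square_eq)
  qed
  have sq: "sqrt (1 - q\<^sup>2) = 1 / C" unfolding Cq using C by (simp add: real_sqrt_divide)
  have sum: "(\<Sum>k<n. \<alpha> k) = pi" using F.sum_\<alpha> ang by simp
  have "harea (region P) = harea F.halfplanes"
    unfolding \<open>region P = S\<close> S_def by (rule harea_half_turn[OF ch H])
  also have "\<dots> = (\<Sum>k<n. pi - 2 * \<alpha> k - 2 * arccos (C * sin (\<alpha> k)))"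
    unfolding F.harea_halfplanes[OF ang q] sq by (simp add: algebra_simps)
  also have "\<dots> = (real n - 2) * pi - 2 * (\<Sum>k<n. arccos (C * sin (\<alpha> k)))"
  proof -
    have "(\<Sum>k<n. pi - 2 * \<alpha> k - 2 * arccos (C * sin (\<alpha> k)))
      = n * pi - 2 * (\<Sum>k<n. \<alpha> k) - 2 * (\<Sum>k<n. arccos (C * sin (\<alpha> k)))"
      by (simp add: sum_subtractf sum_distrib_left)
    then show ?thesis by (simp add: sum algebra_simps)
  qed
  finally have area: "harea (region P) = (real n - 2) * pi - 2 * (\<Sum>k<n. arccos (C * sin (\<alpha> k)))" .
  have C1: "C * sin (\<alpha> k) < 1" for k
  proof -
    have "q\<^sup>2 < (cos (\<alpha> k))\<^sup>2" using q[of k] F.q_pos by (intro power_strict_mono) auto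
    then have "(sin (\<alpha> k))\<^sup>2 < 1 / C\<^sup>2" using Cq by (simp add: sin_squared_eq)
    then have "(C * sin (\<alpha> k))\<^sup>2 < 1\<^sup>2" using C by (simp add: power_mult_distrib field_simps)
    then show ?thesis by (rule power_less_imp_less_base) simp
  qed
  note J = sum_arccos_sin_le[OF C assms(1) sum F.\<alpha>_pos F.\<alpha>_less C1]
  have VS: "vertex P k \<in> S" for k
  proof -
    have "vertex P (k mod n) \<in> side P (k mod n)" by (simp add: side_def)
    then have "vertex P (k mod n) \<in> boundary P" using n0 by (auto simp: boundary_def len)
    moreover have "frontier S \<subseteq> S" using S(1) by (simp add: compact_imp_closed frontier_subset_closed)
    ultimately show ?thesis using vertex_mod[of P k] by (auto simp: bd len)
  qed
  have angle: "interior_angle P i = arccos (1 - 2 * ((cos (\<alpha> i))\<^sup>2 - q\<^sup>2) / (1 - q\<^sup>2))" for i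
  proof -
    \<comment> \<open>The predecessor of \<open>i\<close> modulo \<open>n\<close>, also for
      \<open>i = 0\<close>, so that vertex \<open>i\<close> appears in the middle position
      \<open>Suc k\<close>.\<close>
    define k where "k = i + n - 1"
    have k: "Suc k = i + n" using n0 by (simp add: k_def)
    have per: "vertex P (j + n) = vertex P j" for j by (simp add: vertex_def len)
    have v1: "vertex P (i + length P - 1) = vertex P k" by (simp add: k_def len)
    have v2: "vertex P i = vertex P (Suc k)" by (simp add: vertex_def k len)
    have v3: "vertex P (i + 1) = vertex P (Suc (Suc k))" using per[of "Suc i"] k by simp
    have "\<not> collinear {vertex P i, vertex P (i + length P - 1), vertex P (i + 1)}"
      using hpolygon_not_collinear[OF assms(2) n0, of k] unfolding v1 v2 v3 by (simp add: insert_commute)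
    then have "interior_angle P i = hangle (vertex P i) (vertex P (i + length P - 1) - vertex P i)
      (vertex P (i + 1) - vertex P i)"
      by (rule interior_angle_convex[OF bd bS S(2) VS VS VS])
    also have "\<dots> = hangle (vertex P (Suc k)) (vertex P k - vertex P (Suc k))
      (vertex P (Suc (Suc k)) - vertex P (Suc k))"
      by (simp only: v1 v2 v3)
    also have "\<dots> = hangle (F.V (Suc k)) (F.V k - F.V (Suc k)) (F.V (Suc (Suc k)) - F.V (Suc k))"
      unfolding vV by (rule half_turn_hangle[OF ch Vh Vh Vh])
    also have "\<dots> = arccos (1 - 2 * ((cos (\<alpha> (Suc k)))\<^sup>2 - q\<^sup>2) / (1 - q\<^sup>2))"
      by (rule F.hangle_at_vertex[OF q])
    also have "\<alpha> (Suc k) = \<alpha> i" by (simp only: k F.\<alpha>_periodic)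
    finally show ?thesis .
  qed
  have reg: "regular P \<longleftrightarrow> (\<forall>k<n. \<alpha> k = pi / n)"
  proof
    assume R: "regular P"
    have "\<alpha> k = \<alpha> 0" if k: "k < n" for k
    proof -
      have "interior_angle P k = interior_angle P 0" using R k n0 unfolding regular_def len by blast
      \<comment> \<open>\<open>arccos\<close> can be cancelled only for arguments in
        \<open>[-1, 1]\<close>.\<close>
      moreover have "\<bar>1 - 2 * ((cos (\<alpha> j))\<^sup>2 - q\<^sup>2) / (1 - q\<^sup>2)\<bar> \<le> 1" for j
      proof -
        have "q\<^sup>2 < (cos (\<alpha> j))\<^sup>2" using q[of j] F.q_pos by (intro power_strict_mono) auto
        moreover have "(cos (\<alpha> j))\<^sup>2 \<le> 1" by (simp add: abs_square_le_1)
        ultimately have "0 \<le> ((cos (\<alpha> j))\<^sup>2 - q\<^sup>2) / (1 - q\<^sup>2)" "((cos (\<alpha> j))\<^sup>2 - q\<^sup>2) / (1 - q\<^sup>2) \<le> 1"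
          by (auto simp: divide_simps)
        then show ?thesis by linarith
      qed
      ultimately have "(cos (\<alpha> k))\<^sup>2 = (cos (\<alpha> 0))\<^sup>2"
        using C by (simp add: angle arccos_eq_iff Cq)
      then have cc: "cos (\<alpha> k) = cos (\<alpha> 0)"
        using F.cos_\<alpha>_pos[of k] F.cos_\<alpha>_pos[of 0] by (simp add: power2_eq_iff_nonneg)
      have b: "0 \<le> \<alpha> j" "\<alpha> j \<le> pi" for j
        using F.\<alpha>_pos[of j] F.\<alpha>_less[of j] by linarith+
      show ?thesis by (rule cos_inj_pi[OF b b cc])
    qed
    then have eq: "\<forall>k<n. \<alpha> k = \<alpha> 0" by blast
    have "(\<Sum>k<n. \<alpha> k) = (\<Sum>k<n. \<alpha> 0)"
      by (rule sum.cong[OF refl]) (metis eq lessThan_iff)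
    then have "\<alpha> 0 = pi / n" using sum n0 by (simp add: field_simps)
    with eq show "\<forall>k<n. \<alpha> k = pi / n" by metis
  next
    assume A: "\<forall>k<n. \<alpha> k = pi / n"
    \<comment> \<open>\<open>hdist_sides_equal\<close> speaks of every natural index; periodicity
      carries the equality beyond the first \<open>n\<close>.\<close>
    have all: "\<alpha> k = pi / n" for k
    proof (induction k rule: less_induct)
      case (less k)
      show ?case
      proof (cases "k < n")
        case False
        then show ?thesis using less[of "k - n"] F.\<alpha>_periodic[of "k - n"] n0 by simp
      qed (use A in simp)
    qed
    have "hdist (vertex P i) (vertex P (i + 1)) = hdist (vertex P j) (vertex P (j + 1))" for i j
      using F.hdist_sides_equal[OF all] by (simp add: vV half_turn_hdist[OF ch Vh Vh])
    then show "regular P" by (simp add: regular_def angle all)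
  qed
  have e: "arccos (sin (pi / real n) * cosh r) = arccos (C * sin (pi / n))"
    by (simp add: C_def mult.commute)
  have "2 * (\<Sum>k<n. arccos (C * sin (\<alpha> k))) \<le> 2 * real n * arccos (C * sin (pi / n))"
    using J(1) by simp
  moreover have "(\<Sum>k<n. arccos (C * sin (\<alpha> k))) = n * arccos (C * sin (pi / n)) \<longleftrightarrow>
    2 * (\<Sum>k<n. arccos (C * sin (\<alpha> k))) = 2 * real n * arccos (C * sin (pi / n))" by simp
  ultimately show ?thesis
    unfolding area e reg J(2)[symmetric] by linarith
qed

end
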